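(* Let $a,b>0$, $1<p<5$, $k\ge2$, and let $V:\mathbb{R}^3\to\mathbb{R}$ be a bounded continuous function satisfying (V1) and (V2) (stated in the context) with distinct points $a_1,\dots,a_k\in\mathbb{R}^3$. For each $i$ let $U^{(i)}\in H^1(\mathbb{R}^3)$ be the unique positive radial solution of $$-\left(a+b\int_{\mathbb{R}^3}|\nabla u|^2\right)\Delta u+V(a_i)u=u^p,\quad u>0\quad\text{in }\mathbb{R}^3 .$$ Then the problem $$-\left(\epsilon^2a+\epsilon b\int_{\mathbb{R}^3}|\nabla u|^2\right)\Delta u+V(x)u=u^p,\qquad u>0\quad\text{in }\mathbb{R}^3,$$ has no $k$-peak solutions (as $\epsilon\to0$) of the form $$u_\epsilon(x)=\sum_{i=1}^kU^{(i)}\!\left(\frac{x-y_i}{\epsilon}\right)+\varphi_\epsilon(x),\qquad\text{with }\ \|\varphi_\epsilon\|_\epsilon=o(\epsilon^{3/2}),$$ where the points $y_i=y_i(\epsilon)\in\mathbb{R}^3$ satisfy $y_i\to a_i$ as $\epsilon\to0$ for each $i=1,\dots,k$.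
   Context: Assumptions on $V$: (V1) $V\in L^\infty(\mathbb{R}^3)$ and $0<\inf_{\mathbb{R}^3}V\le\sup_{\mathbb{R}^3}V<\infty$; (V2) there exist $k$ ($k\ge 2$) distinct points $\{a_1,\dots,a_k\}\subset\mathbb{R}^3$ such that for every $1\le i\le k$, $V\in C^{\theta}(\bar B_{R_0}(a_i))$ for some $\theta\in(0,1)$, and $V(a_i)<V(x)$ for $0<|x-a_i|<r$ holds for some $r$ with $0<r<R_0:=\frac12\min_{i\ne j}|a_i-a_j|$. Norm: $\|u\|_\epsilon^2=\int_{\mathbb{R}^3}(\epsilon^2a|\nabla u|^2+V(x)u^2)$. It is known that for each $i$ the positive radial solution $U^{(i)}\in H^1(\mathbb{R}^3)$ exists and is unique. Definition ($k$-peak solution). A family $u_\epsilon$ (for $\epsilon>0$ small) of solutions of the problem is called a $k$-peak solution if: (i) $u_\epsilon$ has $k$ local maximum points $y_\epsilon^j\in\mathbb{R}^3$, $j=1,\dots,k$, with $y_\epsilon^j\to a_j$ for some $a_j\in\mathbb{R}^3$ as $\epsilon\to0$; (ii) for any given $\tau>0$ there exists $R\gg1$ such that $|u_\epsilon(x)|\le\tau$ for $x\in\mathbb{R}^3\setminus\bigcup_{j=1}^kB_{R\epsilon}(y_\epsilon^j)$; (iii) there exists $C>0$ (independent of $\epsilon$) such that $\int_{\mathbb{R}^3}(\epsilon^2a|\nabla u_\epsilon|^2+u_\epsilon^2)\le C\epsilon^3$. *)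

theory Defs
  imports "HOL-Analysis.Analysis" "HOL-Library.Landau_Symbols"
begin

primrec C_k :: "nat \<Rightarrow> (real ^ 3 \<Rightarrow> real) \<Rightarrow> bool" where
  "C_k 0 f \<longleftrightarrow> continuous_on UNIV f"
| "C_k (Suc n) f \<longleftrightarrow>
    (\<exists>g. (\<forall>x. GDERIV f x :> g x) \<and> (\<forall>i. C_k n (\<lambda>x. g x $ i)))"

definition test_function :: "(real ^ 3 \<Rightarrow> real) \<Rightarrow> bool" where
  "test_function \<psi> \<longleftrightarrow> (\<forall>n. C_k n \<psi>) \<and> compact (closure {x. \<psi> x \<noteq> 0})"

definition gradient :: "(real ^ 3 \<Rightarrow> real) \<Rightarrow> real ^ 3 \<Rightarrow> real ^ 3" where
  "gradient f x = (THE D. GDERIV f x :> D)"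

definition square_integrable :: "(real ^ 3 \<Rightarrow> 'b :: euclidean_space) \<Rightarrow> bool" where
  "square_integrable f \<longleftrightarrow>
    f \<in> borel_measurable lebesgue \<and> integrable lebesgue (\<lambda>x. (norm (f x))\<^sup>2)"

definition is_weak_gradient :: "(real ^ 3 \<Rightarrow> real) \<Rightarrow> (real ^ 3 \<Rightarrow> real ^ 3) \<Rightarrow> bool" where
  "is_weak_gradient u g \<longleftrightarrow> square_integrable g \<and>
    (\<forall>\<psi>. test_function \<psi> \<longrightarrow>
      (LINT x|lebesgue. u x *\<^sub>R gradient \<psi> x) = - (LINT x|lebesgue. \<psi> x *\<^sub>R g x))"

text \<open>Elements of $H^1$ are represented by functions rather than by classes modulo null sets.
  The weak gradient is unique up to a null set, so the integrals below do not depend on the choice.\<close>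

definition H1 :: "(real ^ 3 \<Rightarrow> real) \<Rightarrow> bool" where
  "H1 u \<longleftrightarrow> square_integrable u \<and> (\<exists>g. is_weak_gradient u g)"

definition weak_gradient :: "(real ^ 3 \<Rightarrow> real) \<Rightarrow> real ^ 3 \<Rightarrow> real ^ 3" where
  "weak_gradient u = (SOME g. is_weak_gradient u g)"

definition dirichlet_energy :: "(real ^ 3 \<Rightarrow> real) \<Rightarrow> real" where
  "dirichlet_energy u = (LINT x|lebesgue. (norm (weak_gradient u x))\<^sup>2)"

definition eps_norm :: "real \<Rightarrow> (real ^ 3 \<Rightarrow> real) \<Rightarrow> real \<Rightarrow> (real ^ 3 \<Rightarrow> real) \<Rightarrow> real" where
  "eps_norm a V \<epsilon> u =
    sqrt (LINT x|lebesgue. \<epsilon>\<^sup>2 * a * (norm (weak_gradient u x))\<^sup>2 + V x * (u x)\<^sup>2)"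

text \<open>Positive weak solutions in $H^1$ of
  $-(\alpha + \beta \int |\nabla u|^2)\,\Delta u + W u = u^p$ on $R^3$.
  The integrability clause only says that $u^p$ defines a distribution (a Bochner integral of a
  non-integrable function would be 0); for $1 < p < 5$ it follows from the
  Sobolev embedding of $H^1$ into $L^6$.\<close>

definition kirchhoff_solution ::
    "real \<Rightarrow> real \<Rightarrow> (real ^ 3 \<Rightarrow> real) \<Rightarrow> real \<Rightarrow> (real ^ 3 \<Rightarrow> real) \<Rightarrow> bool" where
  "kirchhoff_solution \<alpha> \<beta> W p u \<longleftrightarrow>
    H1 u \<and> (\<forall>x. 0 < u x) \<and>
    (\<forall>\<psi>. test_function \<psi> \<longrightarrow>
      integrable lebesgue (\<lambda>x. u x powr p * \<psi> x) \<and>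
      (\<alpha> + \<beta> * dirichlet_energy u) * (LINT x|lebesgue. weak_gradient u x \<bullet> gradient \<psi> x)
        + (LINT x|lebesgue. W x * u x * \<psi> x)
      = (LINT x|lebesgue. u x powr p * \<psi> x))"

definition radial :: "(real ^ 3 \<Rightarrow> real) \<Rightarrow> bool" where
  "radial u \<longleftrightarrow> (\<exists>f. \<forall>x. u x = f (norm x))"

definition holder_on :: "real \<Rightarrow> (real ^ 3) set \<Rightarrow> (real ^ 3 \<Rightarrow> real) \<Rightarrow> bool" where
  "holder_on \<theta> S f \<longleftrightarrow> (\<exists>L. \<forall>x\<in>S. \<forall>y\<in>S. \<bar>f x - f y\<bar> \<le> L * dist x y powr \<theta>)"

definition V1 :: "(real ^ 3 \<Rightarrow> real) \<Rightarrow> bool" where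
  "V1 V \<longleftrightarrow> V \<in> borel_measurable lebesgue \<and> bounded (range V) \<and> 0 < (INF x. V x)"

definition half_min_dist :: "nat \<Rightarrow> (nat \<Rightarrow> real ^ 3) \<Rightarrow> real" where
  "half_min_dist k A =
    Min {dist (A i) (A j) | i j. i \<in> {1..k} \<and> j \<in> {1..k} \<and> i \<noteq> j} / 2"

definition V2 :: "nat \<Rightarrow> (nat \<Rightarrow> real ^ 3) \<Rightarrow> (real ^ 3 \<Rightarrow> real) \<Rightarrow> bool" where
  "V2 k A V \<longleftrightarrow> 2 \<le> k \<and> inj_on A {1..k} \<and>
    (\<forall>i\<in>{1..k}.
      (\<exists>\<theta>. 0 < \<theta> \<and> \<theta> < 1 \<and> holder_on \<theta> (cball (A i) (half_min_dist k A)) V) \<and>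
      (\<exists>r. 0 < r \<and> r < half_min_dist k A \<and>
        (\<forall>x. 0 < dist x (A i) \<and> dist x (A i) < r \<longrightarrow> V (A i) < V x)))"

text \<open>``For $\epsilon > 0$ small'' is rendered by the filter \<open>at_right 0\<close>. The limits \<open>Z j\<close>
  are arbitrary and need not be the points of assumption (V2).\<close>

definition k_peak_solution ::
    "real \<Rightarrow> real \<Rightarrow> real \<Rightarrow> (real ^ 3 \<Rightarrow> real) \<Rightarrow> nat \<Rightarrow> (real \<Rightarrow> real ^ 3 \<Rightarrow> real) \<Rightarrow> bool" where
  "k_peak_solution a b p V k u \<longleftrightarrow>
    (\<forall>\<^sub>F \<epsilon> in at_right 0. kirchhoff_solution (\<epsilon>\<^sup>2 * a) (\<epsilon> * b) V p (u \<epsilon>)) \<and>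
    (\<exists>Y Z.
      (\<forall>\<^sub>F \<epsilon> in at_right 0. inj_on (\<lambda>j. Y j \<epsilon>) {1..k} \<and>
        (\<forall>j\<in>{1..k}. \<forall>\<^sub>F x in nhds (Y j \<epsilon>). u \<epsilon> x \<le> u \<epsilon> (Y j \<epsilon>))) \<and>
      (\<forall>j\<in>{1..k}. (Y j \<longlongrightarrow> Z j) (at_right 0)) \<and>
      (\<forall>\<tau>>0. \<exists>R>1. \<forall>\<^sub>F \<epsilon> in at_right 0.
        \<forall>x. x \<notin> (\<Union>j\<in>{1..k}. ball (Y j \<epsilon>) (R * \<epsilon>)) \<longrightarrow> \<bar>u \<epsilon> x\<bar> \<le> \<tau>)) \<and>
    (\<exists>C>0. \<forall>\<^sub>F \<epsilon> in at_right 0.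
      (LINT x|lebesgue. \<epsilon>\<^sup>2 * a * (norm (weak_gradient (u \<epsilon>) x))\<^sup>2 + (u \<epsilon> x)\<^sup>2) \<le> C * \<epsilon> ^ 3)"

end

theory Submission
  imports Defs
begin

text \<open>
  Blow up at the first bump: put \<open>v x = u\<^sub>\<epsilon> (y\<^sub>1 + \<epsilon> x)\<close>. The coefficients \<open>\<epsilon>\<^sup>2 a\<close> and \<open>\<epsilon> b\<close> are
  scaled so that \<open>v\<close> solves a Kirchhoff equation with the fixed coefficients \<open>a\<close>, \<open>b\<close> and the
  potential \<open>V (y\<^sub>1 + \<epsilon> x)\<close>, which tends to \<open>V (a\<^sub>1)\<close> (\<open>kirchhoff_solution_rescale\<close>).
  In these variables \<open>v\<close> is \<open>U\<^sub>1\<close> plus translates of the other \<open>U\<^sub>i\<close>, which escape to infinity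
  because the points \<open>a\<^sub>i\<close> are distinct, plus a remainder that tends to 0 in \<open>H\<^sup>1\<close>.

  A test function sees only \<open>U\<^sub>1\<close> in the limit (\<open>dispersing_remainder_tendsto_0\<close>), but the nonlocal
  coefficient sees every bump: the Dirichlet energy of \<open>v\<close> tends to the sum \<open>D\<close> of the energies of all
  \<open>U\<^sub>i\<close> (\<open>energy_of_dispersing_sum\<close>). So the limit equation for \<open>U\<^sub>1\<close> has the coefficient \<open>a + b D\<close>,
  while its own equation has \<open>a + b D\<^sub>1\<close> with \<open>D\<^sub>1\<close> the energy of \<open>U\<^sub>1\<close> alone. For the nonlinear term Fatou's
  lemma gives one inequality against nonnegative test functions. Subtracting the two relations leaves
  \<open>b (D - D\<^sub>1) \<integral>\<nabla>U\<^sub>1 \<bullet> \<nabla>\<psi> \<ge> 0\<close> for all test functions \<open>\<psi> \<ge> 0\<close>. Since \<open>D > D\<^sub>1\<close>, the function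
  \<open>U\<^sub>1\<close> is weakly superharmonic.

  This is impossible: a positive superharmonic function on \<open>\<real>\<^sup>3\<close> decays no faster than \<open>1 / |x|\<close>, hence is
  not square integrable (\<open>no_positive_superharmonic_H1\<close>). The same fact shows that each \<open>U\<^sub>i\<close> has
  positive energy, which is why \<open>D > D\<^sub>1\<close> as soon as there are two bumps.

  Weak gradients are picked by a choice operator, so everything above also rests on their almost everywhere
  uniqueness (\<open>weak_gradient_unique\<close>). It is obtained from explicit smooth bumps that converge to the
  indicator functions of boxes.
\<close>

section \<open>Smooth functions and test functions\<close>

definition smooth :: "(real ^ 3 \<Rightarrow> real) \<Rightarrow> bool" where
  "smooth f \<longleftrightarrow> (\<forall>n. C_k n f)"

lemma GDERIV_unique:
  assumes "GDERIV f x :> D" "GDERIV f x :> E"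
  shows "D = E"
proof -
  have "(\<lambda>h. h \<bullet> D) = (\<lambda>h. h \<bullet> E)"
    using assms unfolding gderiv_def by (rule has_derivative_unique)
  then show ?thesis
    by (metis vector_eq_ldot)
qed

lemma gradient_eq: "GDERIV f x :> D \<Longrightarrow> gradient f x = D"
  unfolding gradient_def by (blast intro: GDERIV_unique)

lemma GDERIV_isCont: "GDERIV f x :> D \<Longrightarrow> isCont f x"
  unfolding gderiv_def by (rule has_derivative_continuous)

lemma C_k_continuous: "C_k n f \<Longrightarrow> continuous_on UNIV f"
  by (cases n) (auto simp: continuous_on_eq_continuous_at dest: GDERIV_isCont)

lemma C_k_pred: "C_k (Suc n) f \<Longrightarrow> C_k n f"
proof (induction n arbitrary: f)
  case 0
  then show ?case by (simp add: C_k_continuous del: C_k.simps(2))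
next
  case (Suc n)
  then show ?case by (metis C_k.simps(2))
qed

lemma C_k_const: "C_k n (\<lambda>x. c)"
proof (induction n arbitrary: c)
  case (Suc n)
  have "\<forall>x. GDERIV (\<lambda>x::real^3. c) x :> 0" by (simp add: GDERIV_const)
  moreover have "\<forall>i. C_k n (\<lambda>x::real^3. (0::real^3) $ i)" using Suc by simp
  ultimately show ?case by (auto simp del: zero_index)
qed simp

lemma C_k_add: "C_k n f \<Longrightarrow> C_k n g \<Longrightarrow> C_k n (\<lambda>x. f x + g x)"
proof (induction n arbitrary: f g)
  case 0
  then show ?case by (auto intro: continuous_on_add)
next
  case (Suc n)
  then obtain f' g' where "\<forall>x. GDERIV f x :> f' x" "\<forall>i. C_k n (\<lambda>x. f' x $ i)"
    "\<forall>x. GDERIV g x :> g' x" "\<forall>i. C_k n (\<lambda>x. g' x $ i)" by auto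
  then have "(\<forall>x. GDERIV (\<lambda>x. f x + g x) x :> f' x + g' x) \<and> (\<forall>i. C_k n (\<lambda>x. (f' x + g' x) $ i))"
    using Suc.IH by (auto intro: GDERIV_add)
  then show ?case unfolding C_k.simps by (rule exI[of _ "\<lambda>x. f' x + g' x"])
qed

lemma C_k_mult: "C_k n f \<Longrightarrow> C_k n g \<Longrightarrow> C_k n (\<lambda>x. f x * g x)"
proof (induction n arbitrary: f g)
  case 0
  then show ?case by (auto intro: continuous_on_mult)
next
  case (Suc n)
  then obtain f' g' where "\<forall>x. GDERIV f x :> f' x" "\<forall>i. C_k n (\<lambda>x. f' x $ i)"
    "\<forall>x. GDERIV g x :> g' x" "\<forall>i. C_k n (\<lambda>x. g' x $ i)" by auto
  moreover have "C_k n f" "C_k n g" using Suc.prems by (blast intro: C_k_pred)+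
  ultimately have "(\<forall>x. GDERIV (\<lambda>x. f x * g x) x :> f x *\<^sub>R g' x + g x *\<^sub>R f' x) \<and>
      (\<forall>i. C_k n (\<lambda>x. (f x *\<^sub>R g' x + g x *\<^sub>R f' x) $ i))"
    using Suc.IH by (auto intro!: GDERIV_mult C_k_add)
  then show ?case unfolding C_k.simps by (rule exI[of _ "\<lambda>x. f x *\<^sub>R g' x + g x *\<^sub>R f' x"])
qed

text \<open>The chain rule for smooth outer functions. The function \<open>F m\<close> is the \<open>m\<close>-th derivative of \<open>F 0\<close>, and
  all of them are treated at once, because the gradient of \<open>F m \<circ> q\<close> involves \<open>F (Suc m) \<circ> q\<close>. The set \<open>S\<close>
  allows outer functions such as powers that are differentiable only on part of the line.\<close>
lemma C_k_compose:
  assumes F: "\<And>m t. t \<in> S \<Longrightarrow> (F m has_real_derivative F (Suc m) t) (at t)"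
    and q: "smooth q" and S: "\<And>x. q x \<in> S"
  shows "C_k n (\<lambda>x. F m (q x))"
proof (induction n arbitrary: m)
  case 0
  have "continuous_on UNIV q" using q C_k_continuous by (auto simp: smooth_def)
  moreover have "isCont (F m) (q x)" for x
    using F[OF S] by (rule DERIV_isCont)
  ultimately show ?case
    by (auto simp: continuous_on_eq_continuous_at intro: isCont_o2)
next
  case (Suc n)
  have "C_k (Suc n) q" using q by (simp add: smooth_def del: C_k.simps)
  then obtain g where "\<forall>x. GDERIV q x :> g x" "\<forall>i. C_k n (\<lambda>x. g x $ i)" by auto
  then have "(\<forall>x. GDERIV (\<lambda>x. F m (q x)) x :> F (Suc m) (q x) *\<^sub>R g x) \<and>
      (\<forall>i. C_k n (\<lambda>x. (F (Suc m) (q x) *\<^sub>R g x) $ i))"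
    using Suc.IH F[OF S] by (auto intro!: GDERIV_DERIV_compose[of q] C_k_mult)
  then show ?case unfolding C_k.simps by (rule exI[of _ "\<lambda>x. F (Suc m) (q x) *\<^sub>R g x"])
qed

lemma smooth_compose:
  assumes "\<And>m t. t \<in> S \<Longrightarrow> (F m has_real_derivative F (Suc m) t) (at t)"
    and "smooth q" and "\<And>x. q x \<in> S"
  shows "smooth (\<lambda>x. F m (q x))"
  using C_k_compose[of S F q, OF assms] by (simp add: smooth_def)

lemma GDERIV_affine:
  assumes "GDERIV f (t + c *\<^sub>R x) :> D"
  shows "GDERIV (\<lambda>x. f (t + c *\<^sub>R x)) x :> c *\<^sub>R D"
proof -
  have "((\<lambda>x. t + c *\<^sub>R x) has_derivative (\<lambda>h. c *\<^sub>R h)) (at x)"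
    by (auto intro!: derivative_eq_intros)
  from has_derivative_compose[OF this assms[unfolded gderiv_def]]
  show ?thesis by (simp add: gderiv_def)
qed

lemma C_k_affine: "C_k n f \<Longrightarrow> C_k n (\<lambda>x. f (t + c *\<^sub>R x))"
proof (induction n arbitrary: f)
  case 0
  then show ?case
    by (auto intro!: continuous_intros intro: continuous_on_compose2[of UNIV f])
next
  case (Suc n)
  then obtain g where "\<forall>x. GDERIV f x :> g x" "\<forall>i. C_k n (\<lambda>x. g x $ i)" by auto
  then have "(\<forall>x. GDERIV (\<lambda>x. f (t + c *\<^sub>R x)) x :> c *\<^sub>R g (t + c *\<^sub>R x)) \<and>
      (\<forall>i. C_k n (\<lambda>x. (c *\<^sub>R g (t + c *\<^sub>R x)) $ i))"
    using Suc.IH by (auto intro!: GDERIV_affine C_k_mult C_k_const)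
  then show ?case unfolding C_k.simps by (rule exI[of _ "\<lambda>x. c *\<^sub>R g (t + c *\<^sub>R x)"])
qed

lemma smooth_const: "smooth (\<lambda>x. c)"
  by (simp add: smooth_def C_k_const)

lemma smooth_add: "smooth f \<Longrightarrow> smooth g \<Longrightarrow> smooth (\<lambda>x. f x + g x)"
  by (simp add: smooth_def C_k_add)

lemma smooth_mult: "smooth f \<Longrightarrow> smooth g \<Longrightarrow> smooth (\<lambda>x. f x * g x)"
  by (simp add: smooth_def C_k_mult)

lemma smooth_diff:
  assumes "smooth f" "smooth g" shows "smooth (\<lambda>x. f x - g x)"
  using smooth_add[OF assms(1) smooth_mult[OF smooth_const[of "-1"] assms(2)]] by simp

lemma smooth_sum: "(\<And>i. i \<in> I \<Longrightarrow> smooth (f i)) \<Longrightarrow> smooth (\<lambda>x. \<Sum>i\<in>I. f i x)"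
  by (induction I rule: infinite_finite_induct) (auto intro: smooth_const smooth_add)

lemma smooth_prod: "(\<And>i. i \<in> I \<Longrightarrow> smooth (f i)) \<Longrightarrow> smooth (\<lambda>x. \<Prod>i\<in>I. f i x)"
  by (induction I rule: infinite_finite_induct) (auto intro: smooth_const smooth_mult)

lemma smooth_affine: "smooth f \<Longrightarrow> smooth (\<lambda>x. f (t + c *\<^sub>R x))"
  by (simp add: smooth_def C_k_affine)

lemma smooth_component: "smooth (\<lambda>x. x $ i)"
  unfolding smooth_def
proof
  fix n
  have "GDERIV (\<lambda>x. x $ i) x :> axis i (1::real)" for x :: "real ^ 3"
    unfolding gderiv_def inner_axis by (auto intro!: bounded_linear_imp_has_derivative bounded_linear_vec_nth)
  then have "C_k (Suc n) (\<lambda>x. x $ i)"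
    unfolding C_k.simps by (intro exI[of _ "\<lambda>x. axis i 1"]) (auto intro: C_k_const)
  then show "C_k n (\<lambda>x. x $ i)" by (rule C_k_pred)
qed

lemma smooth_inner_self: "smooth (\<lambda>x. x \<bullet> x)"
  unfolding inner_vec_def inner_real_def by (intro smooth_sum smooth_mult smooth_component)

lemma smooth_GDERIV: "smooth f \<Longrightarrow> GDERIV f x :> gradient f x"
proof -
  assume "smooth f"
  then have "C_k (Suc 0) f" unfolding smooth_def by blast
  then obtain g where "\<forall>x. GDERIV f x :> g x" by auto
  then show ?thesis using gradient_eq by metis
qed

lemma smooth_partial:
  assumes "smooth f" shows "smooth (\<lambda>x. gradient f x $ i)"
  unfolding smooth_def
proof
  fix n
  have "C_k (Suc n) f" using assms unfolding smooth_def by blast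
  then obtain g where g: "\<forall>x. GDERIV f x :> g x" "\<forall>i. C_k n (\<lambda>x. g x $ i)" by auto
  then have "gradient f = g" using gradient_eq by blast
  then show "C_k n (\<lambda>x. gradient f x $ i)" using g by simp
qed

lemma smooth_continuous: "smooth f \<Longrightarrow> continuous_on UNIV f"
  using C_k_continuous unfolding smooth_def by blast

lemma smooth_gradient_continuous: "smooth f \<Longrightarrow> continuous_on UNIV (gradient f)"
  using smooth_continuous[OF smooth_partial]
  by (subst continuous_on_componentwise) (auto simp: Basis_vec_def inner_axis)

lemma test_function_smooth: "test_function \<psi> \<Longrightarrow> smooth \<psi>"
  by (simp add: test_function_def smooth_def)

lemma test_functionI:
  assumes "smooth \<psi>" and "\<And>x. \<psi> x \<noteq> 0 \<Longrightarrow> x \<in> K" and "bounded K"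
  shows "test_function \<psi>"
proof -
  have "bounded {x. \<psi> x \<noteq> 0}" using assms(2) by (intro bounded_subset[OF assms(3)]) auto
  then show ?thesis using assms(1) by (simp add: test_function_def smooth_def)
qed

lemma gradient_support:
  assumes "x \<notin> closure {x. \<psi> x \<noteq> 0}"
  shows "gradient \<psi> x = 0"
proof (rule gradient_eq)
  let ?S = "- closure {x. \<psi> x \<noteq> 0}"
  have "open ?S" by (rule open_Compl) (rule closed_closure)
  moreover have "x \<in> ?S" using assms unfolding Compl_iff .
  moreover have "0 = \<psi> y" if "y \<in> ?S" for y
  proof -
    have "\<psi> y = 0" using that closure_subset[of "{x. \<psi> x \<noteq> 0}"] by blast
    then show ?thesis by (rule sym)
  qed
  moreover have "((\<lambda>x. 0) has_derivative (\<lambda>h. h \<bullet> 0)) (at x)"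
    by simp
  ultimately have "(\<psi> has_derivative (\<lambda>h. h \<bullet> 0)) (at x)"
    using has_derivative_transform_within_open by blast
  then show "GDERIV \<psi> x :> 0" unfolding gderiv_def .
qed

text \<open>This allows to test the definition of a weak gradient with partial derivatives, which is how second
  derivatives of test functions enter later.\<close>
lemma test_function_partial:
  assumes "test_function \<psi>"
  shows "test_function (\<lambda>x. gradient \<psi> x $ i)"
proof (rule test_functionI)
  show "smooth (\<lambda>x. gradient \<psi> x $ i)"
    using assms by (intro smooth_partial test_function_smooth)
  show "bounded (closure {x. \<psi> x \<noteq> 0})"
    using assms by (auto simp: test_function_def compact_imp_bounded)
  show "x \<in> closure {x. \<psi> x \<noteq> 0}" if "gradient \<psi> x $ i \<noteq> 0" for x
  proof (rule ccontr)
    assume "x \<notin> closure {x. \<psi> x \<noteq> 0}"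
    then have "gradient \<psi> x = 0" by (rule gradient_support)
    with that show False by simp
  qed
qed

lemma test_function_affine:
  assumes "test_function \<psi>" and "c \<noteq> 0"
  shows "test_function (\<lambda>x. \<psi> (t + c *\<^sub>R x))"
proof (rule test_functionI)
  let ?K = "closure {x. \<psi> x \<noteq> 0}"
  show "smooth (\<lambda>x. \<psi> (t + c *\<^sub>R x))"
    by (rule smooth_affine[OF test_function_smooth[OF assms(1)]])
  have "bounded ?K" using assms by (auto simp: test_function_def compact_imp_bounded)
  then show "bounded ((\<lambda>y. (- (1 / c) *\<^sub>R t) + (1 / c) *\<^sub>R y) ` ?K)"
    using bounded_translation[OF bounded_scaling, of ?K "- (1 / c) *\<^sub>R t" "1 / c"]
    by (simp add: image_image)
  show "x \<in> (\<lambda>y. (- (1 / c) *\<^sub>R t) + (1 / c) *\<^sub>R y) ` ?K" if "\<psi> (t + c *\<^sub>R x) \<noteq> 0" for x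
  proof (rule image_eqI)
    show "x = - (1 / c) *\<^sub>R t + (1 / c) *\<^sub>R (t + c *\<^sub>R x)"
      using assms(2) by (simp add: algebra_simps)
    show "t + c *\<^sub>R x \<in> ?K" using that closure_subset[of "{x. \<psi> x \<noteq> 0}"] by auto
  qed
qed

section \<open>A smooth bump\<close>

text \<open>For \<open>t > 0\<close> the \<open>m\<close>-th derivative of \<open>exp (- 1 / t)\<close> is \<open>p (1 / t) * exp (- 1 / t)\<close> for a polynomial
  \<open>p\<close>. Differentiating once more replaces \<open>p\<close> by \<open>x\<^sup>2 (p - p')\<close>.\<close>
primrec flat_poly :: "nat \<Rightarrow> real poly" where
  "flat_poly 0 = 1"
| "flat_poly (Suc m) = [:0, 0, 1:] * (flat_poly m - pderiv (flat_poly m))"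

text \<open>The \<open>m\<close>-th derivative of the standard smooth function that is flat at 0; the function itself is
  \<open>flat 0\<close>.\<close>
definition flat :: "nat \<Rightarrow> real \<Rightarrow> real" where
  "flat m t = (if t > 0 then poly (flat_poly m) (1 / t) * exp (- (1 / t)) else 0)"

lemma poly_times_exp_minus_tendsto_0:
  "((\<lambda>x. poly P x * exp (- x)) \<longlongrightarrow> 0) (at_top :: real filter)"
proof -
  have "((\<lambda>x. \<Sum>i\<le>degree P. coeff P i * (x ^ i / exp x)) \<longlongrightarrow> (\<Sum>i\<le>degree P. coeff P i * 0)) at_top"
    by (intro tendsto_intros tendsto_power_div_exp_0)
  then show ?thesis
    by (simp add: poly_altdef sum_divide_distrib exp_minus field_simps)
qed

text \<open>Only the point 0 needs care: the difference quotient from the right is again a polynomial in \<open>1 / h\<close>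
  times \<open>exp (- 1 / h)\<close>, and the exponential wins.\<close>
lemma flat_has_derivative: "(flat m has_real_derivative flat (Suc m) t) (at t)"
proof -
  consider "t > 0" | "t < 0" | "t = 0" by linarith
  then show ?thesis
  proof cases
    case 1
    have "((\<lambda>t. poly (flat_poly m) (1 / t) * exp (- (1 / t))) has_real_derivative flat (Suc m) t) (at t)"
      using 1 by (auto intro!: derivative_eq_intros poly_DERIV DERIV_chain2[of "poly (flat_poly m)"]
          simp: flat_def field_simps power2_eq_square)
    then show ?thesis
      by (rule has_field_derivative_transform_within_open[of _ _ _ "{0<..}"]) (use 1 in \<open>auto simp: flat_def\<close>)
  next
    case 2
    have "((\<lambda>t. 0) has_real_derivative flat (Suc m) t) (at t)"
      using 2 by (simp add: flat_def)
    then show ?thesis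
      by (rule has_field_derivative_transform_within_open[of _ _ _ "{..<0}"]) (use 2 in \<open>auto simp: flat_def\<close>)
  next
    case 3
    have "((\<lambda>h. flat m h / h) \<longlongrightarrow> 0) (at_left 0)"
    proof (rule tendsto_eventually)
      show "\<forall>\<^sub>F h in at_left 0. flat m h / h = 0"
        by (auto simp: eventually_at_left_field flat_def intro!: exI[of _ "-1"])
    qed
    moreover have "((\<lambda>h. flat m h / h) \<longlongrightarrow> 0) (at_right 0)"
    proof -
      have "((\<lambda>h. poly (pCons 0 (flat_poly m)) (inverse h) * exp (- inverse h)) \<longlongrightarrow> 0) (at_right 0)"
        by (rule filterlim_compose[OF poly_times_exp_minus_tendsto_0 filterlim_inverse_at_top_right])
      then show ?thesis
        by (rule Lim_transform_eventually)
           (auto simp: eventually_at_right_field flat_def field_simps intro!: exI[of _ 1])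
    qed
    ultimately have "((\<lambda>h. flat m h / h) \<longlongrightarrow> 0) (at 0)"
      by (rule filterlim_split_at_real)
    then show ?thesis using 3 by (simp add: has_field_derivative_iff flat_def)
  qed
qed

lemma flat_0_pos: "t > 0 \<Longrightarrow> flat 0 t > 0"
  and flat_0_nonneg: "flat 0 t \<ge> 0"
  and flat_0_le_1: "flat 0 t \<le> 1"
  and flat_nonpos: "t \<le> 0 \<Longrightarrow> flat m t = 0"
  by (auto simp: flat_def)

lemma flat_0_mono: "s \<le> t \<Longrightarrow> flat 0 s \<le> flat 0 t"
  by (auto simp: flat_def frac_le)

lemma smooth_flat: "smooth q \<Longrightarrow> smooth (\<lambda>x. flat m (q x))"
  by (rule smooth_compose[of UNIV flat]) (auto intro: flat_has_derivative)

lemma continuous_on_flat: "continuous_on S (flat m)"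
  by (intro continuous_at_imp_continuous_on ballI DERIV_isCont[OF flat_has_derivative])

lemma smooth_inverse_sqrt_one_plus_inner_self: "smooth (\<lambda>x. (1 + x \<bullet> x) powr (- 1 / 2))"
proof -
  define F :: "nat \<Rightarrow> real \<Rightarrow> real" where
    "F m t = (\<Prod>j<m. - 1 / 2 - real j) * (1 + t) powr (- 1 / 2 - real m)" for m t
  have D: "(F m has_real_derivative F (Suc m) t) (at t)" if "t \<in> {-1<..}" for m t
  proof -
    have "((\<lambda>t. (1 + t) powr (- 1 / 2 - real m)) has_real_derivative
        (- 1 / 2 - real m) * (1 + t) powr (- 1 / 2 - real m - 1)) (at t)"
      using that by (auto intro!: derivative_eq_intros)
    from DERIV_cmult[OF this, of "\<Prod>j<m. - 1 / 2 - real j"] show ?thesis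
      by (simp add: F_def[abs_def] mult.assoc diff_diff_eq add.commute)
  qed
  have S: "x \<bullet> x \<in> {-1<..}" for x :: "real ^ 3"
    using inner_ge_zero[of x] by (simp del: inner_ge_zero)
  have "smooth (\<lambda>x. F 0 (x \<bullet> x))"
    using D smooth_inner_self S
    by (rule smooth_compose[where S = "{-1<..}" and F = F and m = 0 and q = "\<lambda>x. x \<bullet> x"])
  then show ?thesis by (simp add: F_def)
qed


section \<open>Square integrable functions\<close>
definition l2norm :: "(real ^ 3 \<Rightarrow> 'b :: euclidean_space) \<Rightarrow> real" where
  "l2norm f = sqrt (LINT x|lebesgue. (norm (f x))\<^sup>2)"

lemma l2norm_nonneg: "0 \<le> l2norm f"
  by (simp add: l2norm_def)

lemma l2norm_power2: "(l2norm f)\<^sup>2 = (LINT x|lebesgue. (norm (f x))\<^sup>2)"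
  by (simp add: l2norm_def)

lemma square_integrable_measurable:
  "square_integrable f \<Longrightarrow> f \<in> borel_measurable lebesgue"
  by (simp add: square_integrable_def)

lemma square_integrable_bound:
  assumes "square_integrable g" and "f \<in> borel_measurable lebesgue"
    and "\<And>x. norm (f x) \<le> norm (g x)"
  shows "square_integrable f"
  unfolding square_integrable_def
proof
  show "integrable lebesgue (\<lambda>x. (norm (f x))\<^sup>2)"
  proof (rule Bochner_Integration.integrable_bound)
    show "integrable lebesgue (\<lambda>x. (norm (g x))\<^sup>2)"
      using assms(1) by (simp add: square_integrable_def)
    show "(\<lambda>x. (norm (f x))\<^sup>2) \<in> borel_measurable lebesgue"
      using assms(2) by measurable
  qed (use assms(3) in \<open>auto intro: power_mono\<close>)
qed (rule assms(2))

lemma integrable_norm_mult_norm: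
  assumes "square_integrable f" "square_integrable g"
  shows "integrable lebesgue (\<lambda>x. norm (f x) * norm (g x))"
proof (rule Bochner_Integration.integrable_bound)
  have [measurable]: "f \<in> borel_measurable lebesgue" "g \<in> borel_measurable lebesgue"
    using assms by (auto dest: square_integrable_measurable)
  show "(\<lambda>x. norm (f x) * norm (g x)) \<in> borel_measurable lebesgue" by measurable
  show "integrable lebesgue (\<lambda>x. (norm (f x))\<^sup>2 + (norm (g x))\<^sup>2)"
    using assms by (auto simp: square_integrable_def)
  have "norm (f x) * norm (g x) \<le> (norm (f x))\<^sup>2 + (norm (g x))\<^sup>2" for x
    using sum_squares_bound[of "norm (f x)" "norm (g x)"] mult_nonneg_nonneg[OF norm_ge_zero[of "f x"] norm_ge_zero[of "g x"]]
    by linarith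
  then show "AE x in lebesgue. norm (norm (f x) * norm (g x)) \<le> norm ((norm (f x))\<^sup>2 + (norm (g x))\<^sup>2)"
    by simp
qed

lemma integrable_scaleR:
  fixes f :: "real ^ 3 \<Rightarrow> real"
  assumes "square_integrable f" "square_integrable g"
  shows "integrable lebesgue (\<lambda>x. f x *\<^sub>R g x)"
proof (rule Bochner_Integration.integrable_bound[OF integrable_norm_mult_norm[OF assms]])
  have [measurable]: "f \<in> borel_measurable lebesgue" "g \<in> borel_measurable lebesgue"
    using assms by (auto dest: square_integrable_measurable)
  show "(\<lambda>x. f x *\<^sub>R g x) \<in> borel_measurable lebesgue" by measurable
qed simp

lemma integrable_inner:
  assumes "square_integrable f" "square_integrable g"
  shows "integrable lebesgue (\<lambda>x. f x \<bullet> g x)"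
proof (rule Bochner_Integration.integrable_bound[OF integrable_norm_mult_norm[OF assms]])
  have [measurable]: "f \<in> borel_measurable lebesgue" "g \<in> borel_measurable lebesgue"
    using assms by (auto dest: square_integrable_measurable)
  show "(\<lambda>x. f x \<bullet> g x) \<in> borel_measurable lebesgue" by measurable
qed (simp add: Cauchy_Schwarz_ineq2)

lemma nn_integral_norm_power2:
  assumes "square_integrable h"
  shows "(\<integral>\<^sup>+x. ennreal ((norm (h x))\<^sup>2) \<partial>lebesgue) = ennreal ((l2norm h)\<^sup>2)"
  using assms unfolding l2norm_power2
  by (subst nn_integral_eq_integral[symmetric]) (auto simp: square_integrable_def)

lemma l2_Cauchy_Schwarz:
  assumes "square_integrable f" "square_integrable g"
  shows "(LINT x|lebesgue. norm (f x) * norm (g x)) \<le> l2norm f * l2norm g"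
proof -
  have [measurable]: "f \<in> borel_measurable lebesgue" "g \<in> borel_measurable lebesgue"
    using assms by (auto dest: square_integrable_measurable)
  let ?I = "LINT x|lebesgue. norm (f x) * norm (g x)"
  have "(\<integral>\<^sup>+x. ennreal (norm (f x)) * ennreal (norm (g x)) \<partial>lebesgue)\<^sup>2
      \<le> (\<integral>\<^sup>+x. (ennreal (norm (f x)))\<^sup>2 \<partial>lebesgue) * (\<integral>\<^sup>+x. (ennreal (norm (g x)))\<^sup>2 \<partial>lebesgue)"
    by (rule Cauchy_Schwarz_nn_integral) measurable
  moreover have "(\<integral>\<^sup>+x. ennreal (norm (f x)) * ennreal (norm (g x)) \<partial>lebesgue) = ennreal ?I"
    using integrable_norm_mult_norm[OF assms]
    by (subst nn_integral_eq_integral[symmetric]) (auto simp: ennreal_mult)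
  ultimately have "ennreal (?I\<^sup>2) \<le> ennreal ((l2norm f)\<^sup>2) * ennreal ((l2norm g)\<^sup>2)"
    by (simp add: nn_integral_norm_power2 assms ennreal_power del: power_mult_distrib)
  then have "ennreal (?I\<^sup>2) \<le> ennreal ((l2norm f)\<^sup>2 * (l2norm g)\<^sup>2)"
    by (simp add: ennreal_mult)
  then have "?I\<^sup>2 \<le> (l2norm f * l2norm g)\<^sup>2"
    by (simp add: power_mult_distrib)
  then show ?thesis
    by (rule power2_le_imp_le) (simp add: l2norm_nonneg)
qed

lemma abs_integral_inner_le_integral_norm:
  assumes "square_integrable f" "square_integrable g"
  shows "\<bar>LINT x|lebesgue. f x \<bullet> g x\<bar> \<le> (LINT x|lebesgue. norm (f x) * norm (g x))"
proof -
  have "\<bar>LINT x|lebesgue. f x \<bullet> g x\<bar> \<le> (LINT x|lebesgue. \<bar>f x \<bullet> g x\<bar>)"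
    by (rule integral_abs_bound)
  also have "\<dots> \<le> (LINT x|lebesgue. norm (f x) * norm (g x))"
    by (intro integral_mono integrable_abs integrable_inner integrable_norm_mult_norm assms
        Cauchy_Schwarz_ineq2)
  finally show ?thesis .
qed

lemma abs_integral_inner_le:
  assumes "square_integrable f" "square_integrable g"
  shows "\<bar>LINT x|lebesgue. f x \<bullet> g x\<bar> \<le> l2norm f * l2norm g"
  using abs_integral_inner_le_integral_norm[OF assms] l2_Cauchy_Schwarz[OF assms] by linarith

lemma square_integrable_0: "square_integrable (\<lambda>x. 0)"
  by (simp add: square_integrable_def)

lemma square_integrable_add:
  assumes "square_integrable f" "square_integrable g"
  shows "square_integrable (\<lambda>x. f x + g x)"
  unfolding square_integrable_def
proof
  have [measurable]: "f \<in> borel_measurable lebesgue" "g \<in> borel_measurable lebesgue"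
    using assms by (auto dest: square_integrable_measurable)
  show "(\<lambda>x. f x + g x) \<in> borel_measurable lebesgue" by measurable
  have "integrable lebesgue (\<lambda>x. (norm (f x))\<^sup>2 + (norm (g x))\<^sup>2 + 2 * (f x \<bullet> g x))"
    using assms integrable_inner[OF assms] by (auto simp: square_integrable_def)
  then show "integrable lebesgue (\<lambda>x. (norm (f x + g x))\<^sup>2)"
    by (simp add: power2_norm_eq_inner inner_add_left inner_add_right inner_commute algebra_simps)
qed

lemma square_integrable_sum:
  "(\<And>i. i \<in> I \<Longrightarrow> square_integrable (f i)) \<Longrightarrow> square_integrable (\<lambda>x. \<Sum>i\<in>I. f i x)"
  by (induction I rule: infinite_finite_induct) (auto intro: square_integrable_add square_integrable_0)

lemma square_integrable_scaleR:
  assumes "square_integrable f" shows "square_integrable (\<lambda>x. c *\<^sub>R f x)"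
  using assms by (auto simp: square_integrable_def power_mult_distrib)

lemma square_integrable_diff:
  assumes "square_integrable f" "square_integrable g"
  shows "square_integrable (\<lambda>x. f x - g x)"
  using square_integrable_add[OF assms(1) square_integrable_scaleR[OF assms(2), of "-1"]] by simp

lemma square_integrable_indicator:
  assumes "square_integrable f" and [measurable]: "A \<in> sets lebesgue"
  shows "square_integrable (\<lambda>x. indicator A x *\<^sub>R f x)"
proof (rule square_integrable_bound[OF assms(1)])
  have [measurable]: "f \<in> borel_measurable lebesgue"
    using assms by (auto dest: square_integrable_measurable)
  show "(\<lambda>x. indicator A x *\<^sub>R f x) \<in> borel_measurable lebesgue" by measurable
qed (auto simp: indicator_def)

section \<open>Affine changes of variables\<close>
lemma lebesgue_density_affine:
  fixes t :: "'a :: euclidean_space"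
  assumes "c \<noteq> 0"
  shows "lebesgue = density (distr lebesgue lebesgue (\<lambda>x. t + c *\<^sub>R x)) (\<lambda>_. \<bar>c\<bar> ^ DIM('a))"
    and measurable_affine: "(\<lambda>x. t + c *\<^sub>R x) \<in> lebesgue \<rightarrow>\<^sub>M lebesgue"
proof -
  have "(\<Sum>j\<in>Basis. (c * (x \<bullet> j)) *\<^sub>R j) = c *\<^sub>R x" for x :: 'a
    by (simp add: scaleR_scaleR[symmetric] scaleR_sum_right[symmetric] euclidean_representation del: scaleR_scaleR)
  with assms lebesgue_affine_euclidean[of "\<lambda>_. c" t] lebesgue_affine_measurable[of "\<lambda>_. c" t]
  show "lebesgue = density (distr lebesgue lebesgue (\<lambda>x. t + c *\<^sub>R x)) (\<lambda>_. \<bar>c\<bar> ^ DIM('a))"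
    "(\<lambda>x. t + c *\<^sub>R x) \<in> lebesgue \<rightarrow>\<^sub>M lebesgue"
    by simp_all
qed

lemma borel_measurable_affine_comp:
  fixes t :: "'a :: euclidean_space"
  assumes "f \<in> borel_measurable lebesgue" and "c \<noteq> 0"
  shows "(\<lambda>x. f (t + c *\<^sub>R x)) \<in> borel_measurable lebesgue"
  by (rule measurable_compose[OF measurable_affine[OF assms(2)] assms(1)])

lemma integrable_affine_iff:
  fixes f :: "'a :: euclidean_space \<Rightarrow> 'b :: {banach, second_countable_topology}"
  assumes f: "f \<in> borel_measurable lebesgue" and c: "c \<noteq> 0"
  shows "integrable lebesgue (\<lambda>x. f (t + c *\<^sub>R x)) \<longleftrightarrow> integrable lebesgue f"
proof -
  have "integrable lebesgue f \<longleftrightarrow>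
      integrable (density (distr lebesgue lebesgue (\<lambda>x. t + c *\<^sub>R x)) (\<lambda>_. \<bar>c\<bar> ^ DIM('a))) f"
    using lebesgue_density_affine[OF c, of t] by simp
  also have "\<dots> \<longleftrightarrow> integrable (distr lebesgue lebesgue (\<lambda>x. t + c *\<^sub>R x)) (\<lambda>x. \<bar>c\<bar> ^ DIM('a) *\<^sub>R f x)"
    using f by (intro integrable_density) auto
  also have "\<dots> \<longleftrightarrow> integrable lebesgue (\<lambda>x. \<bar>c\<bar> ^ DIM('a) *\<^sub>R f (t + c *\<^sub>R x))"
    using f measurable_affine[OF c, of t] by (subst integrable_distr_eq) auto
  also have "\<dots> \<longleftrightarrow> integrable lebesgue (\<lambda>x. f (t + c *\<^sub>R x))"
  proof
    assume "integrable lebesgue (\<lambda>x. \<bar>c\<bar> ^ DIM('a) *\<^sub>R f (t + c *\<^sub>R x))"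
    from integrable_scaleR_right[OF this, of "inverse (\<bar>c\<bar> ^ DIM('a))"] c
    show "integrable lebesgue (\<lambda>x. f (t + c *\<^sub>R x))" by simp
  qed simp
  finally show ?thesis ..
qed

lemma integral_affine:
  fixes f :: "'a :: euclidean_space \<Rightarrow> 'b :: {banach, second_countable_topology}"
  assumes f: "f \<in> borel_measurable lebesgue" and c: "c \<noteq> 0"
  shows "(LINT x|lebesgue. f x) = \<bar>c\<bar> ^ DIM('a) *\<^sub>R (LINT x|lebesgue. f (t + c *\<^sub>R x))"
proof -
  have "(LINT x|lebesgue. f x) =
      (LINT x|density (distr lebesgue lebesgue (\<lambda>x. t + c *\<^sub>R x)) (\<lambda>_. \<bar>c\<bar> ^ DIM('a)). f x)"
    using lebesgue_density_affine[OF c, of t] by simp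
  also have "\<dots> = (LINT x|distr lebesgue lebesgue (\<lambda>x. t + c *\<^sub>R x). \<bar>c\<bar> ^ DIM('a) *\<^sub>R f x)"
    using f by (intro integral_density) auto
  also have "\<dots> = (LINT x|lebesgue. \<bar>c\<bar> ^ DIM('a) *\<^sub>R f (t + c *\<^sub>R x))"
    using f measurable_affine[OF c, of t] by (subst integral_distr) auto
  finally show ?thesis by simp
qed

lemma square_integrable_affine:
  assumes "square_integrable f" and c: "c \<noteq> 0"
  shows "square_integrable (\<lambda>x. f (t + c *\<^sub>R x))"
  unfolding square_integrable_def
proof
  have [measurable]: "f \<in> borel_measurable lebesgue"
    using assms by (auto dest: square_integrable_measurable)
  then show "(\<lambda>x. f (t + c *\<^sub>R x)) \<in> borel_measurable lebesgue"
    using c by (rule borel_measurable_affine_comp)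
  show "integrable lebesgue (\<lambda>x. (norm (f (t + c *\<^sub>R x)))\<^sup>2)"
    using assms by (subst integrable_affine_iff[of "\<lambda>x. (norm (f x))\<^sup>2"]) (auto simp: square_integrable_def)
qed

lemma square_integrable_translate:
  "square_integrable f \<Longrightarrow> square_integrable (\<lambda>x. f (x + z))"
  using square_integrable_affine[of f 1 z] by (simp add: add.commute)

lemma l2norm_affine:
  assumes "square_integrable f" and c: "c \<noteq> 0"
  shows "(l2norm f)\<^sup>2 = \<bar>c\<bar> ^ 3 * (l2norm (\<lambda>x. f (t + c *\<^sub>R x)))\<^sup>2"
proof -
  have [measurable]: "f \<in> borel_measurable lebesgue"
    using assms by (auto dest: square_integrable_measurable)
  show ?thesis
    unfolding l2norm_power2
    using integral_affine[of "\<lambda>x. (norm (f x))\<^sup>2" c t] c by simp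
qed

lemma l2norm_translate:
  assumes "square_integrable f"
  shows "l2norm (\<lambda>x. f (x + z)) = l2norm f"
proof -
  have "(l2norm f)\<^sup>2 = (l2norm (\<lambda>x. f (x + z)))\<^sup>2"
    using l2norm_affine[OF assms, of 1 z] by (simp add: add.commute)
  then show ?thesis by (simp add: l2norm_nonneg power2_eq_iff_nonneg)
qed

section \<open>Translates that escape to infinity\<close>
lemma l2norm_tail_tendsto_0:
  assumes "square_integrable f"
  shows "((\<lambda>R. l2norm (\<lambda>x. indicator (- ball 0 R) x *\<^sub>R f x)) \<longlongrightarrow> 0) at_top"
proof -
  have "((\<lambda>R. LINT x|lebesgue. (norm (indicator (- ball 0 R) x *\<^sub>R f x))\<^sup>2)
      \<longlongrightarrow> (LINT x|(lebesgue :: (real ^ 3) measure). (0::real))) at_top"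
  proof (rule integral_dominated_convergence_at_top)
    show "integrable lebesgue (\<lambda>x. (norm (f x))\<^sup>2)" using assms by (simp add: square_integrable_def)
    show "AE x in lebesgue. ((\<lambda>R. (norm (indicator (- ball 0 R) x *\<^sub>R f x))\<^sup>2) \<longlongrightarrow> 0) at_top"
    proof (rule AE_I2)
      fix x :: "real ^ 3"
      have "\<forall>\<^sub>F R in at_top. norm x < R" by (rule eventually_gt_at_top)
      then have "\<forall>\<^sub>F R in at_top. (norm (indicator (- ball 0 R) x *\<^sub>R f x))\<^sup>2 = 0"
        by eventually_elim (simp add: indicator_def)
      then show "((\<lambda>R. (norm (indicator (- ball 0 R) x *\<^sub>R f x))\<^sup>2) \<longlongrightarrow> 0) at_top"
        by (rule tendsto_eventually)
    qed
    show "(\<lambda>x. (norm (indicator (- ball 0 R) x *\<^sub>R f x))\<^sup>2) \<in> borel_measurable lebesgue" for R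
      by (rule borel_measurable_power[OF measurable_compose[OF square_integrable_measurable[OF
          square_integrable_indicator[OF assms]] borel_measurable_norm]]) simp
  qed (auto simp: indicator_def intro!: always_eventually)
  then have "((\<lambda>R. sqrt (LINT x|lebesgue. (norm (indicator (- ball 0 R) x *\<^sub>R f x))\<^sup>2)) \<longlongrightarrow> sqrt 0) at_top"
    by (intro tendsto_real_sqrt) simp
  then show ?thesis by (simp add: l2norm_def)
qed

text \<open>Two square integrable profiles decouple when one of them is moved to infinity: at each point either
  \<open>x\<close> or \<open>x + z n\<close> has norm at least \<open>norm (z n) / 2\<close>, so one of the two factors only contributes its tail.\<close>
lemma integral_translate_product_tendsto_0:
  fixes f :: "real ^ 3 \<Rightarrow> 'a :: euclidean_space" and g :: "real ^ 3 \<Rightarrow> 'b :: euclidean_space"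
  assumes f: "square_integrable f" and g: "square_integrable g"
    and z: "filterlim (\<lambda>n. norm (z n)) at_top F"
  shows "((\<lambda>n. LINT x|lebesgue. norm (f x) * norm (g (x + z n))) \<longlongrightarrow> 0) F"
proof -
  have tail: "- ball 0 R \<in> sets lebesgue" for R :: real by simp
  let ?f = "\<lambda>n x. indicator (- ball 0 (norm (z n) / 2)) x *\<^sub>R f x"
  let ?g = "\<lambda>n x. indicator (- ball 0 (norm (z n) / 2)) x *\<^sub>R g x"
  have bound: "(LINT x|lebesgue. norm (f x) * norm (g (x + z n)))
      \<le> l2norm (?f n) * l2norm g + l2norm f * l2norm (?g n)" for n
  proof -
    note si = square_integrable_translate square_integrable_indicator[OF _ tail] f g
    have si': "square_integrable (\<lambda>x. ?g n (x + z n))"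
      by (rule square_integrable_translate[of "?g n"]) (intro si)
    have pw: "norm (f x) * norm (g (x + z n)) \<le>
        norm (?f n x) * norm (g (x + z n)) + norm (f x) * norm (?g n (x + z n))" for x
    proof -
      have "norm (z n) \<le> norm x + norm (x + z n)"
        using norm_triangle_ineq4[of "x + z n" x] by simp
      then have "x \<in> - ball 0 (norm (z n) / 2) \<or> x + z n \<in> - ball 0 (norm (z n) / 2)"
        by auto
      then show ?thesis by (auto simp: indicator_def)
    qed
    have "(LINT x|lebesgue. norm (f x) * norm (g (x + z n))) \<le>
        (LINT x|lebesgue. norm (?f n x) * norm (g (x + z n)) + norm (f x) * norm (?g n (x + z n)))"
      by (intro integral_mono Bochner_Integration.integrable_add integrable_norm_mult_norm si si' pw)
    also have "\<dots> = (LINT x|lebesgue. norm (?f n x) * norm (g (x + z n))) +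
        (LINT x|lebesgue. norm (f x) * norm (?g n (x + z n)))"
      by (intro Bochner_Integration.integral_add integrable_norm_mult_norm si si')
    also have "\<dots> \<le> l2norm (?f n) * l2norm (\<lambda>x. g (x + z n)) + l2norm f * l2norm (\<lambda>x. ?g n (x + z n))"
      by (intro add_mono l2_Cauchy_Schwarz si si')
    also have "l2norm (\<lambda>x. g (x + z n)) = l2norm g" by (intro l2norm_translate g)
    also have "l2norm (\<lambda>x. ?g n (x + z n)) = l2norm (?g n)"
      by (rule l2norm_translate[of "?g n"]) (intro si)
    finally show ?thesis .
  qed
  have z2: "filterlim (\<lambda>n. norm (z n) / 2) at_top F"
    using filterlim_tendsto_pos_mult_at_top[OF tendsto_const[of "1/2"] _ z] by simp
  have "((\<lambda>n. l2norm (?f n)) \<longlongrightarrow> 0) F" "((\<lambda>n. l2norm (?g n)) \<longlongrightarrow> 0) F"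
    by (rule filterlim_compose[OF l2norm_tail_tendsto_0[OF f] z2]
        filterlim_compose[OF l2norm_tail_tendsto_0[OF g] z2])+
  then have "((\<lambda>n. l2norm (?f n) * l2norm g + l2norm f * l2norm (?g n)) \<longlongrightarrow> 0 * l2norm g + l2norm f * 0) F"
    by (intro tendsto_intros)
  then have lim: "((\<lambda>n. l2norm (?f n) * l2norm g + l2norm f * l2norm (?g n)) \<longlongrightarrow> 0) F" by simp
  have "norm (LINT x|lebesgue. norm (f x) * norm (g (x + z n)))
      \<le> l2norm (?f n) * l2norm g + l2norm f * l2norm (?g n)" for n
    using bound[of n] by (simp add: integral_nonneg_AE)
  then show ?thesis
    by (intro Lim_null_comparison[OF always_eventually lim]) blast
qed



section \<open>The fundamental lemma of the calculus of variations\<close>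
lemma continuous_compact_support_integrable:
  fixes f :: "real ^ 3 \<Rightarrow> 'b :: {banach, second_countable_topology}"
  assumes "continuous_on UNIV f" and "compact K" and "\<And>x. x \<notin> K \<Longrightarrow> f x = 0"
  shows "integrable lebesgue f"
proof -
  have "integrable lborel (\<lambda>x. indicator K x *\<^sub>R f x)"
    using assms(1,2) by (intro borel_integrable_compact) (auto intro: continuous_on_subset)
  moreover have "(\<lambda>x. indicator K x *\<^sub>R f x) = f"
    using assms(3) by (auto simp: indicator_def)
  ultimately have "integrable lborel f" by simp
  then show ?thesis
    using integrable_completion borel_measurable_integrable by blast
qed

lemma continuous_measurable_lebesgue:
  fixes f :: "real ^ 3 \<Rightarrow> 'b :: euclidean_space"
  assumes "continuous_on UNIV f"
  shows "f \<in> borel_measurable lebesgue"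
  using borel_measurable_continuous_onI[OF assms]
  by (simp add: measurable_completion)

lemma continuous_compact_support_square_integrable:
  fixes f :: "real ^ 3 \<Rightarrow> 'b :: euclidean_space"
  assumes "continuous_on UNIV f" and "compact K" and "\<And>x. x \<notin> K \<Longrightarrow> f x = 0"
  shows "square_integrable f"
  unfolding square_integrable_def
proof
  show "f \<in> borel_measurable lebesgue"
    by (rule continuous_measurable_lebesgue) (rule assms(1))
  show "integrable lebesgue (\<lambda>x. (norm (f x))\<^sup>2)"
    using assms(1) by (intro continuous_compact_support_integrable[OF _ assms(2)])
      (auto intro!: continuous_intros simp: assms(3))
qed

lemma test_function_square_integrable:
  assumes "test_function \<psi>" shows "square_integrable \<psi>"
proof (rule continuous_compact_support_square_integrable)
  show "continuous_on UNIV \<psi>" using assms by (intro smooth_continuous test_function_smooth)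
  show "compact (closure {x. \<psi> x \<noteq> 0})" using assms by (simp add: test_function_def)
  show "\<psi> x = 0" if "x \<notin> closure {x. \<psi> x \<noteq> 0}" for x
    using that closure_subset[of "{x. \<psi> x \<noteq> 0}"] by blast
qed

lemma test_function_gradient_square_integrable:
  assumes "test_function \<psi>" shows "square_integrable (gradient \<psi>)"
proof (rule continuous_compact_support_square_integrable)
  show "continuous_on UNIV (gradient \<psi>)"
    using assms by (intro smooth_gradient_continuous test_function_smooth)
  show "compact (closure {x. \<psi> x \<noteq> 0})" using assms by (simp add: test_function_def)
  show "gradient \<psi> x = 0" if "x \<notin> closure {x. \<psi> x \<noteq> 0}" for x
    using that by (rule gradient_support)
qed

lemma square_integrable_indicator_one:
  assumes "A \<in> sets lebesgue" "bounded A"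
  shows "square_integrable (indicator A :: real ^ 3 \<Rightarrow> real)"
  unfolding square_integrable_def
proof
  show "indicator A \<in> borel_measurable lebesgue" using assms(1) by measurable
  have "integrable lebesgue (indicator A :: real ^ 3 \<Rightarrow> real)"
    using fmeasurableD2[OF bounded_set_imp_lmeasurable[OF assms(2,1)]] assms(1)
    by (intro integrable_real_indicator) (simp_all add: less_top)
  moreover have "(\<lambda>x. (norm (indicator A x :: real))\<^sup>2) = indicator A"
    by (auto simp: indicator_def)
  ultimately show "integrable lebesgue (\<lambda>x. (norm (indicator A x :: real))\<^sup>2)"
    by metis
qed

text \<open>Since \<open>flat 0 (n s)\<close> tends to 1 for \<open>s > 0\<close> and vanishes for \<open>s \<le> 0\<close>, these products of one-dimensional
  bumps converge pointwise to the indicator function of the open box, and they are bounded by it.\<close>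
definition box_bump :: "real ^ 3 \<Rightarrow> real ^ 3 \<Rightarrow> nat \<Rightarrow> real ^ 3 \<Rightarrow> real" where
  "box_bump a b n x = (\<Prod>i\<in>UNIV. flat 0 (real n * (x $ i - a $ i)) * flat 0 (real n * (b $ i - x $ i)))"

lemma box_bump_outside:
  assumes "x \<notin> box a b" shows "box_bump a b n x = 0"
proof -
  obtain i where "x $ i \<le> a $ i \<or> b $ i \<le> x $ i"
    using assms by (auto simp: mem_box_cart not_less)
  then have "flat 0 (real n * (x $ i - a $ i)) = 0 \<or> flat 0 (real n * (b $ i - x $ i)) = 0"
    by (auto intro!: flat_nonpos mult_nonneg_nonpos)
  then have "flat 0 (real n * (x $ i - a $ i)) * flat 0 (real n * (b $ i - x $ i)) = 0"
    by simp
  then show ?thesis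
    unfolding box_bump_def by (intro prod_zero) auto
qed

lemma box_bump_bounds: "0 \<le> box_bump a b n x \<and> box_bump a b n x \<le> 1"
  unfolding box_bump_def
  by (auto intro!: prod_nonneg prod_le_1 mult_nonneg_nonneg mult_le_one flat_0_nonneg flat_0_le_1)

lemma flat_0_scaled_tendsto_1:
  assumes "s > 0" shows "(\<lambda>n. flat 0 (real n * s)) \<longlonglongrightarrow> 1"
proof -
  have "(\<lambda>n. exp (- (inverse s * inverse (real n)))) \<longlonglongrightarrow> exp (- (inverse s * 0))"
    by (intro tendsto_intros lim_inverse_n)
  then have "(\<lambda>n. exp (- (inverse s * inverse (real n)))) \<longlonglongrightarrow> 1" by simp
  then show ?thesis
  proof (rule Lim_transform_eventually)
    show "\<forall>\<^sub>F n in sequentially. exp (- (inverse s * inverse (real n))) = flat 0 (real n * s)"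
      using eventually_gt_at_top[of 0]
      by eventually_elim (use assms in \<open>simp add: flat_def field_simps\<close>)
  qed
qed

lemma box_bump_tendsto_indicator: "(\<lambda>n. box_bump a b n x) \<longlonglongrightarrow> indicator (box a b) x"
proof (cases "x \<in> box a b")
  case True
  have "(\<lambda>n. box_bump a b n x) \<longlonglongrightarrow> (\<Prod>i\<in>(UNIV :: 3 set). 1 * 1)"
    unfolding box_bump_def using True
    by (intro tendsto_prod tendsto_mult flat_0_scaled_tendsto_1) (auto simp: mem_box_cart)
  then show ?thesis using True by simp
qed (simp add: box_bump_outside)

lemma test_function_box_bump: "test_function (box_bump a b n)"
proof (rule test_functionI)
  show "smooth (box_bump a b n)"
    unfolding box_bump_def[abs_def]
    by (intro smooth_prod smooth_mult smooth_flat smooth_diff smooth_component smooth_const)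
  show "x \<in> box a b" if "box_bump a b n x \<noteq> 0" for x
    using that box_bump_outside by blast
qed (rule bounded_box)

lemma fundamental_lemma_box:
  fixes g :: "real ^ 3 \<Rightarrow> 'b :: euclidean_space"
  assumes g: "square_integrable g"
    and orth: "\<And>\<psi>. test_function \<psi> \<Longrightarrow> (LINT x|lebesgue. \<psi> x *\<^sub>R g x) = 0"
  shows "(LINT x|lebesgue. indicator (box a b) x *\<^sub>R g x) = 0"
proof (rule LIMSEQ_unique)
  show "(\<lambda>n. LINT x|lebesgue. box_bump a b n x *\<^sub>R g x) \<longlonglongrightarrow>
      (LINT x|lebesgue. indicator (box a b) x *\<^sub>R g x)"
  proof (rule integral_dominated_convergence[where w = "\<lambda>x. norm (indicator (box a b) x *\<^sub>R g x)"])
    have 1: "integrable lebesgue (\<lambda>x. indicator (box a b) x *\<^sub>R g x)"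
      by (intro integrable_scaleR square_integrable_indicator_one g) auto
    then show "(\<lambda>x. indicator (box a b) x *\<^sub>R g x) \<in> borel_measurable lebesgue" by simp
    from 1 show "integrable lebesgue (\<lambda>x. norm (indicator (box a b) x *\<^sub>R g x))" by (rule integrable_norm)
    show "(\<lambda>x. box_bump a b n x *\<^sub>R g x) \<in> borel_measurable lebesgue" for n
      by (intro borel_measurable_integrable integrable_scaleR g
          test_function_square_integrable test_function_box_bump)
    show "AE x in lebesgue. (\<lambda>n. box_bump a b n x *\<^sub>R g x) \<longlonglongrightarrow> indicator (box a b) x *\<^sub>R g x"
      by (intro AE_I2 tendsto_intros box_bump_tendsto_indicator)
    show "AE x in lebesgue. norm (box_bump a b n x *\<^sub>R g x) \<le> norm (indicator (box a b) x *\<^sub>R g x)" for n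
    proof (rule AE_I2)
      fix x
      show "norm (box_bump a b n x *\<^sub>R g x) \<le> norm (indicator (box a b) x *\<^sub>R g x)"
        using box_bump_outside[of x a b n] box_bump_bounds[of a b n x]
        by (cases "x \<in> box a b") (auto intro: mult_left_le_one_le)
    qed
  qed
  show "(\<lambda>n. LINT x|lebesgue. box_bump a b n x *\<^sub>R g x) \<longlonglongrightarrow> 0"
    using orth[OF test_function_box_bump] by simp
qed

lemma sigma_finite_lebesgue: "sigma_finite_measure (lebesgue :: 'a :: euclidean_space measure)"
proof
  obtain A :: "'a set set" where "countable A" "A \<subseteq> sets lborel" "\<Union>A = space lborel"
      "\<forall>a\<in>A. emeasure lborel a \<noteq> \<infinity>"
    using lborel.sigma_finite_countable by blast
  then show "\<exists>A :: 'a set set. countable A \<and> A \<subseteq> sets lebesgue \<and> \<Union>A = space lebesgue \<and>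
      (\<forall>a\<in>A. emeasure lebesgue a \<noteq> \<infinity>)"
    by (intro exI[of _ A]) auto
qed

text \<open>Boxes form an intersection-stable generator of the Borel sets, so the integrals vanish over all Borel
  sets by a Dynkin argument, and over all Lebesgue sets because these differ from Borel sets by null sets.\<close>
lemma integral_zero_on_boxes_imp_AE_zero:
  fixes f :: "'a :: euclidean_space \<Rightarrow> 'b :: euclidean_space"
  assumes f: "integrable lebesgue f" and zero: "(LINT x|lebesgue. f x) = 0"
    and box: "\<And>a b. (LINT x:box a b|lebesgue. f x) = 0"
  shows "AE x in lebesgue. f x = 0"
proof (rule sigma_finite_measure.density_zero[OF sigma_finite_lebesgue f])
  have set_int: "set_integrable lebesgue B f" if "B \<in> sets lebesgue" for B
    using that f unfolding set_integrable_def by (rule integrable_mult_indicator)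
  have sets_borel: "sets borel = sigma_sets UNIV (range (\<lambda>(a, b). box a b :: 'a set))"
    by (subst borel_eq_box) simp
  have borel: "(LINT x:B|lebesgue. f x) = 0" if "B \<in> sets borel" for B
  proof -
    have "Int_stable (range (\<lambda>(a, b). box a b :: 'a set))"
      by (auto simp: Int_stable_def box_Int_box)
    moreover have "range (\<lambda>(a, b). box a b :: 'a set) \<subseteq> Pow UNIV" by simp
    moreover have "B \<in> sigma_sets UNIV (range (\<lambda>(a, b). box a b))"
      using that unfolding sets_borel .
    ultimately show ?thesis
    proof (induction rule: sigma_sets_induct_disjoint)
      case (basic A)
      then show ?case using box by auto
    next
      case empty
      show ?case by (simp add: set_lebesgue_integral_def)
    next
      case (compl A)
      then have A: "A \<in> sets lebesgue" by (simp flip: sets_borel)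
      have "(LINT x:A \<union> (UNIV - A)|lebesgue. f x) =
          (LINT x:A|lebesgue. f x) + (LINT x:UNIV - A|lebesgue. f x)"
        using A by (intro set_integral_Un set_int) auto
      then show ?case using compl zero by (simp add: set_lebesgue_integral_def)
    next
      case (union A)
      then have A: "A i \<in> sets lebesgue" for i by (auto simp flip: sets_borel)
      then have "(LINT x:(\<Union>i. A i)|lebesgue. f x) = (\<Sum>i. LINT x:A i|lebesgue. f x)"
        using union(1) by (intro lebesgue_integral_countable_add set_int) (auto simp: disjoint_family_on_def)
      then show ?case using union by simp
    qed
  qed
  fix B :: "'a set" assume "B \<in> sets lebesgue"
  then obtain S N N' where B: "B = S \<union> N" "N \<subseteq> N'" "N' \<in> null_sets lborel" "S \<in> sets lborel"
    by (rule sets_completionE)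
  have "AE x in lebesgue. x \<notin> N'"
    using B(3) by (intro AE_not_in null_sets_completionI)
  then have "(LINT x:B|lebesgue. f x) = (LINT x:S|lebesgue. f x)"
    unfolding set_lebesgue_integral_def
  proof (intro integral_cong_AE)
    have "set_integrable lebesgue B f" "set_integrable lebesgue S f"
      using set_int \<open>B \<in> sets lebesgue\<close> B(4) by auto
    then show "(\<lambda>x. indicator B x *\<^sub>R f x) \<in> borel_measurable lebesgue"
      "(\<lambda>x. indicator S x *\<^sub>R f x) \<in> borel_measurable lebesgue"
      unfolding set_integrable_def by (auto dest: borel_measurable_integrable)
    assume "AE x in lebesgue. x \<notin> N'"
    then show "AE x in lebesgue. indicator B x *\<^sub>R f x = indicator S x *\<^sub>R f x"
      by eventually_elim (use B(1,2) in \<open>auto simp: indicator_def\<close>)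
  qed
  then show "(LINT x:B|lebesgue. f x) = 0" using borel[of S] B by simp
qed

text \<open>A square integrable function need not be integrable on the whole space, so it is first restricted to
  large cubes.\<close>
lemma fundamental_lemma:
  fixes g :: "real ^ 3 \<Rightarrow> 'b :: euclidean_space"
  assumes g: "square_integrable g"
    and orth: "\<And>\<psi>. test_function \<psi> \<Longrightarrow> (LINT x|lebesgue. \<psi> x *\<^sub>R g x) = 0"
  shows "AE x in lebesgue. g x = 0"
proof -
  define Q :: "nat \<Rightarrow> (real ^ 3) set" where "Q n = box (\<chi> i. - real n) (\<chi> i. real n)" for n
  have "AE x in lebesgue. indicator (Q n) x *\<^sub>R g x = 0" for n
  proof (rule integral_zero_on_boxes_imp_AE_zero)
    show "integrable lebesgue (\<lambda>x. indicator (Q n) x *\<^sub>R g x)"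
      unfolding Q_def by (intro integrable_scaleR square_integrable_indicator_one g) auto
    show "(LINT x|lebesgue. indicator (Q n) x *\<^sub>R g x) = 0"
      unfolding Q_def by (rule fundamental_lemma_box[OF assms])
    show "(LINT x:box a b|lebesgue. indicator (Q n) x *\<^sub>R g x) = 0" for a b
    proof -
      obtain c d where "box a b \<inter> Q n = box c d" unfolding Q_def box_Int_box by blast
      then have "(indicator (box a b) x * indicator (Q n) x :: real) = indicator (box c d) x" for x
        by (metis indicator_inter_arith)
      then show ?thesis
        using fundamental_lemma_box[OF assms] by (simp add: set_lebesgue_integral_def)
    qed
  qed
  then have "AE x in lebesgue. \<forall>n. indicator (Q n) x *\<^sub>R g x = 0"
    by (simp only: AE_all_countable) blast
  moreover have "AE x in lebesgue. \<exists>n. x \<in> Q n"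
  proof (rule AE_I2)
    fix x :: "real ^ 3"
    obtain n :: nat where "norm x < n" using reals_Archimedean2 by blast
    then have "\<bar>x $ i\<bar> < n" for i using component_le_norm_cart[of x i] by linarith
    then have "x \<in> Q n" unfolding Q_def mem_box_cart by (simp add: abs_less_iff minus_less_iff)
    then show "\<exists>n. x \<in> Q n" ..
  qed
  ultimately show ?thesis
  proof eventually_elim
    case (elim x)
    then obtain n where "x \<in> Q n" by blast
    then show ?case using elim(1) by (auto dest: spec[of _ n])
  qed
qed

section \<open>Weak gradients\<close>
lemma is_weak_gradient_square_integrable: "is_weak_gradient u g \<Longrightarrow> square_integrable g"
  by (simp add: is_weak_gradient_def)

lemma H1_square_integrable: "H1 u \<Longrightarrow> square_integrable u"
  by (simp add: H1_def)

lemma H1_weak_gradient: "H1 u \<Longrightarrow> is_weak_gradient u (weak_gradient u)"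
  using someI_ex[of "is_weak_gradient u"] unfolding H1_def weak_gradient_def by blast

lemma H1_weak_gradient_square_integrable: "H1 u \<Longrightarrow> square_integrable (weak_gradient u)"
  by (rule is_weak_gradient_square_integrable[OF H1_weak_gradient])

lemma weak_gradient_unique:
  assumes g: "is_weak_gradient u g" and h: "is_weak_gradient u h"
  shows "AE x in lebesgue. g x = h x"
proof -
  have si: "square_integrable g" "square_integrable h"
    using assms by (auto dest: is_weak_gradient_square_integrable)
  have "AE x in lebesgue. g x - h x = 0"
  proof (rule fundamental_lemma)
    show "square_integrable (\<lambda>x. g x - h x)" by (intro square_integrable_diff si)
    fix \<psi> :: "real ^ 3 \<Rightarrow> real" assume \<psi>: "test_function \<psi>"
    have "(LINT x|lebesgue. \<psi> x *\<^sub>R g x) = (LINT x|lebesgue. \<psi> x *\<^sub>R h x)"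
    proof -
      have "(LINT x|lebesgue. u x *\<^sub>R gradient \<psi> x) = - (LINT x|lebesgue. \<psi> x *\<^sub>R g x)"
        "(LINT x|lebesgue. u x *\<^sub>R gradient \<psi> x) = - (LINT x|lebesgue. \<psi> x *\<^sub>R h x)"
        using g h \<psi> unfolding is_weak_gradient_def by blast+
      then show ?thesis by simp
    qed
    moreover have "integrable lebesgue (\<lambda>x. \<psi> x *\<^sub>R g x)" "integrable lebesgue (\<lambda>x. \<psi> x *\<^sub>R h x)"
      using si test_function_square_integrable[OF \<psi>] by (auto intro: integrable_scaleR)
    ultimately show "(LINT x|lebesgue. \<psi> x *\<^sub>R (g x - h x)) = 0"
      by (simp add: scaleR_diff_right)
  qed
  then show ?thesis by simp
qed

lemma AE_eq_weak_gradient: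
  assumes "square_integrable u" "is_weak_gradient u g"
  shows "AE x in lebesgue. weak_gradient u x = g x"
  using assms by (intro weak_gradient_unique[OF H1_weak_gradient]) (auto simp: H1_def)

lemma is_weak_gradient_0: "is_weak_gradient (\<lambda>x. 0) (\<lambda>x. 0)"
  by (simp add: is_weak_gradient_def square_integrable_0)

lemma is_weak_gradient_add:
  assumes u: "square_integrable u" "is_weak_gradient u g"
    and v: "square_integrable v" "is_weak_gradient v h"
  shows "is_weak_gradient (\<lambda>x. u x + v x) (\<lambda>x. g x + h x)"
  unfolding is_weak_gradient_def
proof (intro conjI allI impI)
  have gh: "square_integrable g" "square_integrable h"
    using u v by (auto dest: is_weak_gradient_square_integrable)
  then show "square_integrable (\<lambda>x. g x + h x)" by (rule square_integrable_add)
  fix \<psi> :: "real ^ 3 \<Rightarrow> real" assume \<psi>: "test_function \<psi>"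
  note si = test_function_square_integrable[OF \<psi>] test_function_gradient_square_integrable[OF \<psi>]
  have "(LINT x|lebesgue. u x *\<^sub>R gradient \<psi> x + v x *\<^sub>R gradient \<psi> x) =
      (LINT x|lebesgue. u x *\<^sub>R gradient \<psi> x) + (LINT x|lebesgue. v x *\<^sub>R gradient \<psi> x)"
    by (intro Bochner_Integration.integral_add integrable_scaleR si u v)
  also have "\<dots> = - ((LINT x|lebesgue. \<psi> x *\<^sub>R g x) + (LINT x|lebesgue. \<psi> x *\<^sub>R h x))"
    using u(2) v(2) \<psi> by (simp add: is_weak_gradient_def)
  also have "(LINT x|lebesgue. \<psi> x *\<^sub>R g x) + (LINT x|lebesgue. \<psi> x *\<^sub>R h x) =
      (LINT x|lebesgue. \<psi> x *\<^sub>R g x + \<psi> x *\<^sub>R h x)"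
    by (intro Bochner_Integration.integral_add[symmetric] integrable_scaleR si gh)
  finally show "(LINT x|lebesgue. (u x + v x) *\<^sub>R gradient \<psi> x) = - (LINT x|lebesgue. \<psi> x *\<^sub>R (g x + h x))"
    by (simp add: scaleR_add_left scaleR_add_right)
qed

lemma is_weak_gradient_sum:
  assumes "finite I" "\<And>i. i \<in> I \<Longrightarrow> square_integrable (u i) \<and> is_weak_gradient (u i) (g i)"
  shows "is_weak_gradient (\<lambda>x. \<Sum>i\<in>I. u i x) (\<lambda>x. \<Sum>i\<in>I. g i x)"
  using assms
proof (induction I rule: finite_induct)
  case empty
  then show ?case by (simp add: is_weak_gradient_0)
next
  case (insert i I)
  then show ?case
    by (simp add: is_weak_gradient_add square_integrable_sum)
qed

lemma gradient_affine:
  assumes "smooth \<psi>"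
  shows "gradient (\<lambda>x. \<psi> (t + c *\<^sub>R x)) x = c *\<^sub>R gradient \<psi> (t + c *\<^sub>R x)"
  by (intro gradient_eq GDERIV_affine smooth_GDERIV assms)

text \<open>The affine map is moved onto the test function: \<open>\<eta>\<close> below is \<open>\<psi>\<close> composed with the inverse map.\<close>
lemma is_weak_gradient_affine:
  assumes u: "square_integrable u" "is_weak_gradient u g" and c: "c \<noteq> 0"
  shows "is_weak_gradient (\<lambda>x. u (t + c *\<^sub>R x)) (\<lambda>x. c *\<^sub>R g (t + c *\<^sub>R x))"
  unfolding is_weak_gradient_def
proof (intro conjI allI impI)
  have g: "square_integrable g" using u(2) by (rule is_weak_gradient_square_integrable)
  show "square_integrable (\<lambda>x. c *\<^sub>R g (t + c *\<^sub>R x))"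
    by (intro square_integrable_scaleR square_integrable_affine g c)
  fix \<psi> :: "real ^ 3 \<Rightarrow> real" assume \<psi>: "test_function \<psi>"
  define \<eta> where "\<eta> = (\<lambda>y. \<psi> (- (1 / c) *\<^sub>R t + (1 / c) *\<^sub>R y))"
  have \<eta>: "test_function \<eta>" unfolding \<eta>_def using \<psi> c by (intro test_function_affine) auto
  have inv: "- (1 / c) *\<^sub>R t + (1 / c) *\<^sub>R (t + c *\<^sub>R x) = x" for x
    using c by (simp add: algebra_simps)
  have \<eta>1: "\<eta> (t + c *\<^sub>R x) = \<psi> x" for x
    by (simp add: \<eta>_def inv[simplified])
  have \<eta>2: "gradient \<eta> (t + c *\<^sub>R x) = (1 / c) *\<^sub>R gradient \<psi> x" for x
    unfolding \<eta>_def gradient_affine[OF test_function_smooth[OF \<psi>]] inv ..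
  note si = test_function_square_integrable[OF \<eta>] test_function_gradient_square_integrable[OF \<eta>]
  have "(LINT y|lebesgue. u y *\<^sub>R gradient \<eta> y) =
      \<bar>c\<bar> ^ 3 *\<^sub>R (LINT x|lebesgue. u (t + c *\<^sub>R x) *\<^sub>R gradient \<eta> (t + c *\<^sub>R x))"
    using integral_affine[OF borel_measurable_integrable[OF integrable_scaleR[OF u(1) si(2)]] c] by simp
  moreover have "(LINT y|lebesgue. \<eta> y *\<^sub>R g y) =
      \<bar>c\<bar> ^ 3 *\<^sub>R (LINT x|lebesgue. \<eta> (t + c *\<^sub>R x) *\<^sub>R g (t + c *\<^sub>R x))"
    using integral_affine[OF borel_measurable_integrable[OF integrable_scaleR[OF si(1) g]] c] by simp
  moreover have "(LINT y|lebesgue. u y *\<^sub>R gradient \<eta> y) = - (LINT y|lebesgue. \<eta> y *\<^sub>R g y)"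
    using u(2) \<eta> by (simp add: is_weak_gradient_def)
  ultimately have eq: "\<bar>c\<bar> ^ 3 *\<^sub>R (LINT x|lebesgue. u (t + c *\<^sub>R x) *\<^sub>R (1 / c) *\<^sub>R gradient \<psi> x) =
      \<bar>c\<bar> ^ 3 *\<^sub>R (- (LINT x|lebesgue. \<psi> x *\<^sub>R g (t + c *\<^sub>R x)))"
    unfolding \<eta>1 \<eta>2 by simp
  have "\<bar>c\<bar> ^ 3 \<noteq> 0" using c by simp
  with eq have "(LINT x|lebesgue. u (t + c *\<^sub>R x) *\<^sub>R (1 / c) *\<^sub>R gradient \<psi> x) =
      - (LINT x|lebesgue. \<psi> x *\<^sub>R g (t + c *\<^sub>R x))"
    unfolding scaleR_cancel_left by blast
  then have eq2: "(LINT x|lebesgue. (1 / c) *\<^sub>R u (t + c *\<^sub>R x) *\<^sub>R gradient \<psi> x) =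
      - (LINT x|lebesgue. \<psi> x *\<^sub>R g (t + c *\<^sub>R x))"
    by (simp add: mult.commute)
  have "(LINT x|lebesgue. u (t + c *\<^sub>R x) *\<^sub>R gradient \<psi> x) =
      c *\<^sub>R (LINT x|lebesgue. (1 / c) *\<^sub>R u (t + c *\<^sub>R x) *\<^sub>R gradient \<psi> x)"
    using c by (subst integral_scaleR_right) simp_all
  also have "\<dots> = - (LINT x|lebesgue. \<psi> x *\<^sub>R c *\<^sub>R g (t + c *\<^sub>R x))"
    unfolding eq2 by (simp only: scaleR_left_commute[of _ c] integral_scaleR_right scaleR_minus_right)
  finally show "(LINT x|lebesgue. u (t + c *\<^sub>R x) *\<^sub>R gradient \<psi> x) =
      - (LINT x|lebesgue. \<psi> x *\<^sub>R c *\<^sub>R g (t + c *\<^sub>R x))" .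
qed

lemma dirichlet_energy_eq:
  assumes "square_integrable u" "is_weak_gradient u g"
  shows "dirichlet_energy u = (l2norm g)\<^sup>2"
  unfolding dirichlet_energy_def l2norm_power2
proof (rule integral_cong_AE)
  have "H1 u" using assms by (auto simp: H1_def)
  then have [measurable]: "weak_gradient u \<in> borel_measurable lebesgue" "g \<in> borel_measurable lebesgue"
    using H1_weak_gradient_square_integrable[of u] is_weak_gradient_square_integrable[OF assms(2)]
    by (simp_all add: square_integrable_measurable)
  show "(\<lambda>x. (norm (weak_gradient u x))\<^sup>2) \<in> borel_measurable lebesgue"
    "(\<lambda>x. (norm (g x))\<^sup>2) \<in> borel_measurable lebesgue" by measurable
  show "AE x in lebesgue. (norm (weak_gradient u x))\<^sup>2 = (norm (g x))\<^sup>2"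
    using AE_eq_weak_gradient[OF assms] by eventually_elim simp
qed

lemma integral_weak_gradient_inner:
  assumes "square_integrable u" "is_weak_gradient u g" "square_integrable h"
  shows "(LINT x|lebesgue. weak_gradient u x \<bullet> h x) = (LINT x|lebesgue. g x \<bullet> h x)"
proof (rule integral_cong_AE)
  have "H1 u" using assms by (auto simp: H1_def)
  then show "(\<lambda>x. weak_gradient u x \<bullet> h x) \<in> borel_measurable lebesgue"
    "(\<lambda>x. g x \<bullet> h x) \<in> borel_measurable lebesgue"
    using H1_weak_gradient_square_integrable[of u] is_weak_gradient_square_integrable[OF assms(2)] assms(3)
    by (auto intro!: borel_measurable_integrable integrable_inner)
  show "AE x in lebesgue. weak_gradient u x \<bullet> h x = g x \<bullet> h x"
    using AE_eq_weak_gradient[OF assms(1,2)] by eventually_elim simp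
qed


section \<open>Positive superharmonic functions are not in \<open>H\<^sup>1\<close>\<close>
definition laplacian :: "(real ^ 3 \<Rightarrow> real) \<Rightarrow> real ^ 3 \<Rightarrow> real" where
  "laplacian \<psi> x = (\<Sum>i\<in>UNIV. gradient (\<lambda>y. gradient \<psi> y $ i) x $ i)"

lemma integrable_component:
  fixes f :: "'a \<Rightarrow> real ^ 3"
  assumes "integrable M f"
  shows "integrable M (\<lambda>x. f x $ i)" and "(LINT x|M. f x $ i) = (LINT x|M. f x) $ i"
  using integrable_bounded_linear[OF bounded_linear_vec_nth assms]
    integral_bounded_linear[OF bounded_linear_vec_nth assms] by auto

text \<open>The second integration by parts: component \<open>i\<close> of the defining identity of the weak gradient, tested
  with the \<open>i\<close>-th partial derivative of \<open>\<psi>\<close>, summed over \<open>i\<close>. It is what makes the estimate below close: with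
  first derivatives of a cutoff on scale \<open>R\<close> the error would grow with \<open>R\<close>.\<close>
lemma integral_laplacian:
  assumes u: "square_integrable u" "is_weak_gradient u g" and \<psi>: "test_function \<psi>"
  shows "integrable lebesgue (\<lambda>x. u x * laplacian \<psi> x)"
    and "(LINT x|lebesgue. u x * laplacian \<psi> x) = - (LINT x|lebesgue. g x \<bullet> gradient \<psi> x)"
proof -
  let ?\<psi> = "\<lambda>i y. gradient \<psi> y $ i"
  have test: "test_function (?\<psi> i)" for i by (rule test_function_partial[OF \<psi>])
  have g: "square_integrable g" using u(2) by (rule is_weak_gradient_square_integrable)
  have int1: "integrable lebesgue (\<lambda>x. u x *\<^sub>R gradient (?\<psi> i) x)"
    and int2: "integrable lebesgue (\<lambda>x. ?\<psi> i x *\<^sub>R g x)" for i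
    by (intro integrable_scaleR test_function_gradient_square_integrable test_function_square_integrable
        test u(1) g)+
  have comp1: "integrable lebesgue (\<lambda>x. u x * gradient (?\<psi> i) x $ i)"
    and comp2: "integrable lebesgue (\<lambda>x. ?\<psi> i x * g x $ i)" for i
    using integrable_component(1)[OF int1[of i], of i] integrable_component(1)[OF int2[of i], of i]
    by simp_all
  have "(LINT x|lebesgue. u x * gradient (?\<psi> i) x $ i) = - (LINT x|lebesgue. ?\<psi> i x * g x $ i)" for i
  proof -
    have "(LINT x|lebesgue. u x *\<^sub>R gradient (?\<psi> i) x) = - (LINT x|lebesgue. ?\<psi> i x *\<^sub>R g x)"
      using u(2) test[of i] unfolding is_weak_gradient_def by blast
    then have "(LINT x|lebesgue. u x *\<^sub>R gradient (?\<psi> i) x) $ i = - ((LINT x|lebesgue. ?\<psi> i x *\<^sub>R g x) $ i)"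
      by simp
    then show ?thesis
      by (simp flip: integrable_component(2)[OF int1] integrable_component(2)[OF int2])
  qed
  then have "(\<Sum>i\<in>UNIV. (LINT x|lebesgue. u x * gradient (?\<psi> i) x $ i)) =
      - (\<Sum>i\<in>UNIV. (LINT x|lebesgue. ?\<psi> i x * g x $ i))"
    by (simp add: sum_negf)
  then have "(LINT x|lebesgue. (\<Sum>i\<in>UNIV. u x * gradient (?\<psi> i) x $ i)) =
      - (LINT x|lebesgue. (\<Sum>i\<in>UNIV. ?\<psi> i x * g x $ i))"
    by (simp add: Bochner_Integration.integral_sum comp1 comp2)
  moreover have "g x \<bullet> gradient \<psi> x = (\<Sum>i\<in>UNIV. ?\<psi> i x * g x $ i)" for x
    by (simp add: inner_vec_def mult.commute)
  ultimately show "(LINT x|lebesgue. u x * laplacian \<psi> x) = - (LINT x|lebesgue. g x \<bullet> gradient \<psi> x)"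
    by (simp add: laplacian_def sum_distrib_left)
  show "integrable lebesgue (\<lambda>x. u x * laplacian \<psi> x)"
    using Bochner_Integration.integrable_sum[of UNIV lebesgue, OF comp1]
    by (simp add: laplacian_def sum_distrib_left)
qed

lemma laplacian_radial:
  assumes h: "\<And>t. t \<ge> 0 \<Longrightarrow> (h has_real_derivative h1 t) (at t)"
    "\<And>t. t \<ge> 0 \<Longrightarrow> (h1 has_real_derivative h2 t) (at t)"
  shows "laplacian (\<lambda>x. h (x \<bullet> x)) x = 6 * h1 (x \<bullet> x) + 4 * (x \<bullet> x) * h2 (x \<bullet> x)"
proof -
  have q: "GDERIV (\<lambda>x. x \<bullet> x) x :> 2 *\<^sub>R x" for x :: "real ^ 3"
    unfolding gderiv_def by (auto intro!: derivative_eq_intros simp: inner_commute)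
  have "gradient (\<lambda>x. h (x \<bullet> x)) x = h1 (x \<bullet> x) *\<^sub>R 2 *\<^sub>R x" for x :: "real ^ 3"
    by (rule gradient_eq, rule GDERIV_DERIV_compose[OF q h(1)]) simp
  then have g1: "gradient (\<lambda>x. h (x \<bullet> x)) x $ i = h1 (x \<bullet> x) * (2 * x $ i)" for x :: "real ^ 3" and i
    by simp
  have comp: "GDERIV (\<lambda>x. 2 * x $ i) x :> 2 *\<^sub>R axis i 1" for x :: "real ^ 3" and i
    using has_derivative_mult_right[OF bounded_linear_imp_has_derivative[OF bounded_linear_vec_nth[of i]], of 2 "at x"]
    by (simp add: gderiv_def inner_axis)
  have "gradient (\<lambda>y. h1 (y \<bullet> y) * (2 * y $ i)) x =
      h1 (x \<bullet> x) *\<^sub>R 2 *\<^sub>R axis i 1 + (2 * x $ i) *\<^sub>R h2 (x \<bullet> x) *\<^sub>R 2 *\<^sub>R x" for i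
    by (rule gradient_eq, rule GDERIV_mult[OF GDERIV_DERIV_compose[OF q h(2)] comp]) simp
  then have "laplacian (\<lambda>x. h (x \<bullet> x)) x =
      (\<Sum>i\<in>UNIV. 2 * h1 (x \<bullet> x) + 4 * h2 (x \<bullet> x) * (x $ i * x $ i))"
    unfolding laplacian_def g1 by (simp add: algebra_simps)
  also have "\<dots> = 6 * h1 (x \<bullet> x) + 4 * (x \<bullet> x) * h2 (x \<bullet> x)"
    by (simp add: sum.distrib sum_distrib_left[symmetric] inner_vec_def)
  finally show ?thesis .
qed

text \<open>The second factor is a smooth, bounded, nonnegative subharmonic function, with Laplacian
  \<open>3 (1 + |x|\<^sup>2) powr (- 5 / 2)\<close>: it is 1 minus a smoothed fundamental solution. The first factor is a cutoff on scale \<open>R\<close>.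
  Testing superharmonicity with the product bounds the integral of \<open>u\<close> near the origin by the error that the
  cutoff makes, and that error tends to 0 as \<open>R\<close> grows.\<close>
definition cutoff_barrier :: "real \<Rightarrow> real ^ 3 \<Rightarrow> real" where
  "cutoff_barrier R x = flat 0 (1 - (x \<bullet> x) / R\<^sup>2) * (1 - (1 + x \<bullet> x) powr (- 1 / 2))"

lemma cutoff_barrier_nonneg: "0 \<le> cutoff_barrier R x"
proof -
  have "(1 + x \<bullet> x) powr (- 1 / 2) \<le> 1" 
    using powr_mono2'[of "- 1 / 2" 1 "1 + x \<bullet> x"] by simp
  then show ?thesis by (simp add: cutoff_barrier_def flat_0_nonneg)
qed

lemma test_function_cutoff_barrier:
  assumes "R > 0" shows "test_function (cutoff_barrier R)"
proof (rule test_functionI)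
  have "smooth (\<lambda>x. 1 - (1 / R\<^sup>2) * (x \<bullet> x))"
    by (intro smooth_diff smooth_mult smooth_const smooth_inner_self)
  then have "smooth (\<lambda>x. flat 0 (1 - (x \<bullet> x) / R\<^sup>2))"
    using smooth_flat by force
  then show "smooth (cutoff_barrier R)"
    unfolding cutoff_barrier_def[abs_def]
    by (intro smooth_mult smooth_diff smooth_const smooth_inverse_sqrt_one_plus_inner_self)
  show "bounded (cball 0 R :: (real ^ 3) set)" by simp
  show "x \<in> cball 0 R" if "cutoff_barrier R x \<noteq> 0" for x
  proof (rule ccontr)
    assume "x \<notin> cball 0 R"
    then have "R\<^sup>2 \<le> (norm x)\<^sup>2" using assms by (intro power_mono) auto
    then have "1 - (x \<bullet> x) / R\<^sup>2 \<le> 0" using assms by (simp add: power2_norm_eq_inner)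
    then show False using that by (simp add: cutoff_barrier_def flat_nonpos)
  qed
qed

lemma laplacian_cutoff_barrier:
  fixes x :: "real ^ 3"
  assumes R: "R > 0"
  defines "q \<equiv> x \<bullet> x" and "s \<equiv> 1 - (x \<bullet> x) / R\<^sup>2"
  shows "laplacian (cutoff_barrier R) x =
    3 * flat 0 s * (1 + q) powr (- 5 / 2)
    + (1 - (1 + q) powr (- 1 / 2)) * (4 * q * flat 2 s / R ^ 4 - 6 * flat 1 s / R\<^sup>2)
    - 4 * q * (1 + q) powr (- 3 / 2) * flat 1 s / R\<^sup>2"
proof -
  define h1 where "h1 t = - flat 1 (1 - t / R\<^sup>2) / R\<^sup>2 * (1 - (1 + t) powr (- 1 / 2)) +
      flat 0 (1 - t / R\<^sup>2) * ((1 / 2) * (1 + t) powr (- 3 / 2))" for t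
  define h2 where "h2 t = flat 2 (1 - t / R\<^sup>2) / R ^ 4 * (1 - (1 + t) powr (- 1 / 2))
      - flat 1 (1 - t / R\<^sup>2) / R\<^sup>2 * (1 + t) powr (- 3 / 2)
      - (3 / 4) * flat 0 (1 - t / R\<^sup>2) * (1 + t) powr (- 5 / 2)" for t
  have flat: "((\<lambda>t. flat m (1 - t / R\<^sup>2)) has_real_derivative - flat (Suc m) (1 - t / R\<^sup>2) / R\<^sup>2) (at t)"
    for m t
  proof -
    have "((\<lambda>t. 1 - t / R\<^sup>2) has_real_derivative - (1 / R\<^sup>2)) (at t)"
      using DERIV_diff[OF DERIV_const[of 1] DERIV_cdivide[OF DERIV_ident, of "R\<^sup>2"]] by simp
    from DERIV_chain2[where f = "flat m" and g = "\<lambda>t. 1 - t / R\<^sup>2", OF flat_has_derivative this]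
    show ?thesis by simp
  qed
  have powr: "((\<lambda>t. (1 + t) powr c) has_real_derivative c * (1 + t) powr (c - 1)) (at t)"
    if "t \<ge> 0" for c t :: real
    using that by (auto intro!: derivative_eq_intros)
  have "((\<lambda>t. flat 0 (1 - t / R\<^sup>2) * (1 - (1 + t) powr (- 1 / 2))) has_real_derivative h1 t) (at t)"
    if t: "t \<ge> 0" for t
    using DERIV_mult[OF flat[of 0 t] DERIV_diff[OF DERIV_const[of 1] powr[OF t, of "- 1 / 2"]]]
    by (simp add: h1_def add.commute mult.commute)
  moreover have "(h1 has_real_derivative h2 t) (at t)" if t: "t \<ge> 0" for t
  proof -
    have "(h1 has_real_derivative
        - (- flat (Suc 1) (1 - t / R\<^sup>2) / R\<^sup>2) / R\<^sup>2 * (1 - (1 + t) powr (- 1 / 2)) +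
        (0 - (- 1 / 2) * (1 + t) powr (- 1 / 2 - 1)) * (- flat 1 (1 - t / R\<^sup>2) / R\<^sup>2) +
        (- flat (Suc 0) (1 - t / R\<^sup>2) / R\<^sup>2 * ((1 / 2) * (1 + t) powr (- 3 / 2)) +
        (1 / 2 * ((- 3 / 2) * (1 + t) powr (- 3 / 2 - 1))) * flat 0 (1 - t / R\<^sup>2))) (at t)"
      unfolding h1_def[abs_def]
      by (intro DERIV_add DERIV_mult DERIV_diff DERIV_const DERIV_cdivide DERIV_minus DERIV_cmult flat powr t)
    moreover have "- 1 / 2 - 1 = (- 3 / 2 :: real)" "- 3 / 2 - 1 = (- 5 / 2 :: real)" by simp_all
    ultimately show ?thesis
      unfolding h2_def by (simp add: numeral_2_eq_2 eval_nat_numeral field_simps)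
  qed
  ultimately have "laplacian (cutoff_barrier R) x = 6 * h1 q + 4 * q * h2 q"
    unfolding q_def cutoff_barrier_def[abs_def] by (rule laplacian_radial)
  also have "\<dots> = 3 * flat 0 s * (1 + q) powr (- 5 / 2)
    + (1 - (1 + q) powr (- 1 / 2)) * (4 * q * flat 2 s / R ^ 4 - 6 * flat 1 s / R\<^sup>2)
    - 4 * q * (1 + q) powr (- 3 / 2) * flat 1 s / R\<^sup>2"
  proof -
    have "q \<ge> 0" by (simp add: q_def)
    then have "(1 + q) powr (- 3 / 2) = (1 + q) * (1 + q) powr (- 5 / 2)"
      using powr_add[of "1 + q" 1 "- 5 / 2"] by simp
    moreover have "6 * (- F1 * X * (1 - W) + F0 * ((1 / 2) * ((1 + q) * P)))
        + 4 * q * (F2 * Y * (1 - W) - F1 * X * ((1 + q) * P) - (3 / 4) * F0 * P) =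
      3 * F0 * P + (1 - W) * (4 * q * F2 * Y - 6 * F1 * X) - 4 * q * ((1 + q) * P) * F1 * X"
      for F0 F1 F2 X Y W P :: real
      by algebra
    moreover note this[of "flat 1 s" "1 / R\<^sup>2" "(1 + q) powr (- 1 / 2)" "flat 0 s" "(1 + q) powr (- 5 / 2)"
        "flat 2 s" "1 / R ^ 4"]
    ultimately show ?thesis
      unfolding h1_def h2_def s_def q_def[symmetric]
      by (simp only: times_divide_eq_right mult_1_right)
  qed
  finally show ?thesis .
qed

lemma flat_bounded_on_unit_interval: "\<exists>M. \<forall>s\<in>{0..1}. \<bar>flat m s\<bar> \<le> M"
proof -
  have "bounded (flat m ` {0..1})"
    by (intro compact_imp_bounded compact_continuous_image continuous_on_flat compact_Icc)
  then show ?thesis by (simp add: bounded_iff)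
qed

text \<open>The cutoff contributes an error of size \<open>1 / R\<^sup>2\<close> on the ball of radius \<open>R\<close>, also in the mixed term: there
  the gradient of the cutoff is of order \<open>|x| / R\<^sup>2\<close> and that of the subharmonic factor at most \<open>1 / |x|\<^sup>2\<close> and at most \<open>|x|\<close>.
  For \<open>R \<ge> 2\<close> the argument of the cutoff is at least \<open>3 / 4\<close> on the unit ball.\<close>
lemma laplacian_cutoff_barrier_lower_bound:
  obtains M where "M \<ge> 0" and
    "\<And>R x. R \<ge> 2 \<Longrightarrow> laplacian (cutoff_barrier R) x \<ge>
       3 * flat 0 (3 / 4) * 2 powr (- 5 / 2) * indicator (ball 0 1) x
       - M / R\<^sup>2 * indicator (cball 0 R) x"
proof -
  obtain M0 where M0: "\<And>s. s \<in> {0..1} \<Longrightarrow> \<bar>flat 1 s\<bar> \<le> M0"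
    using flat_bounded_on_unit_interval by blast
  obtain M1 where M1: "\<And>s. s \<in> {0..1} \<Longrightarrow> \<bar>flat 2 s\<bar> \<le> M1"
    using flat_bounded_on_unit_interval by blast
  define M where "M = max M0 M1"
  have M: "\<bar>flat 1 s\<bar> \<le> M" "\<bar>flat 2 s\<bar> \<le> M" if "s \<in> {0..1}" for s
    using M0[OF that] M1[OF that] by (auto simp: M_def)
  have "M \<ge> 0" using M(1)[of 0] by simp
  have "laplacian (cutoff_barrier R) x \<ge> 3 * flat 0 (3 / 4) * 2 powr (- 5 / 2) * indicator (ball 0 1) x
      - 14 * M / R\<^sup>2 * indicator (cball 0 R) x" if R: "R \<ge> 2" for R x
  proof -
    define q where "q = x \<bullet> x"
    define s where "s = 1 - q / R\<^sup>2"
    have q: "q \<ge> 0" "q = (norm x)\<^sup>2" by (simp_all add: q_def power2_norm_eq_inner)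
    have lap: "laplacian (cutoff_barrier R) x =
      3 * flat 0 s * (1 + q) powr (- 5 / 2)
      + (1 - (1 + q) powr (- 1 / 2)) * (4 * q * flat 2 s / R ^ 4 - 6 * flat 1 s / R\<^sup>2)
      - 4 * q * (1 + q) powr (- 3 / 2) * flat 1 s / R\<^sup>2"
      using laplacian_cutoff_barrier[of R x] R by (simp add: q_def s_def)
    show ?thesis
    proof (cases "norm x \<le> R")
      case False
      then have "R\<^sup>2 \<le> q" unfolding q(2) using R by (intro power_mono) auto
      then have "s \<le> 0" using R by (simp add: s_def)
      then show ?thesis using False R by (simp add: lap flat_nonpos)
    next
      case True
      then have qR: "q \<le> R\<^sup>2" unfolding q(2) by (intro power_mono) auto
      then have s: "s \<in> {0..1}" using q R by (simp add: s_def)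
      define w where "w = (1 + q) powr (- 1 / 2)"
      have w: "0 \<le> w" "w \<le> 1"
        using powr_mono2'[of "- 1 / 2" 1 "1 + q"] q by (simp_all add: w_def)
      have w3: "q * (1 + q) powr (- 3 / 2) \<le> 1"
      proof -
        have "(1 + q) * (1 + q) powr (- 3 / 2) = w"
          using powr_add[of "1 + q" 1 "- 3 / 2"] q by (simp add: w_def)
        moreover have "q * (1 + q) powr (- 3 / 2) \<le> (1 + q) * (1 + q) powr (- 3 / 2)"
          by (intro mult_right_mono) auto
        ultimately show ?thesis using w by linarith
      qed
      have F2: "\<bar>4 * q * flat 2 s / R ^ 4\<bar> \<le> 4 * M / R\<^sup>2"
      proof -
        have "q * \<bar>flat 2 s\<bar> \<le> R\<^sup>2 * M" using qR M(2)[OF s] by (intro mult_mono) auto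
        then have "q * \<bar>flat 2 s\<bar> / R ^ 4 \<le> R\<^sup>2 * M / R ^ 4" by (intro divide_right_mono) auto
        also have "\<dots> = M / R\<^sup>2" using R by (simp add: field_simps power2_eq_square power4_eq_xxxx)
        finally show ?thesis using q by (simp add: abs_mult)
      qed
      have F1: "\<bar>6 * flat 1 s / R\<^sup>2\<bar> \<le> 6 * M / R\<^sup>2"
        using M(1)[OF s] by (simp add: abs_mult divide_right_mono)
      have "\<bar>4 * q * flat 2 s / R ^ 4 - 6 * flat 1 s / R\<^sup>2\<bar> \<le> 4 * M / R\<^sup>2 + 6 * M / R\<^sup>2"
        by (rule order_trans[OF abs_triangle_ineq4 add_mono[OF F2 F1]])
      then have diff: "\<bar>4 * q * flat 2 s / R ^ 4 - 6 * flat 1 s / R\<^sup>2\<bar> \<le> 10 * M / R\<^sup>2"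
        by (simp add: add_divide_distrib[symmetric])
      have X: "\<bar>(1 - w) * (4 * q * flat 2 s / R ^ 4 - 6 * flat 1 s / R\<^sup>2)\<bar> \<le> 1 * (10 * M / R\<^sup>2)"
        unfolding abs_mult using w by (intro mult_mono diff) auto
      have Y: "\<bar>4 * q * (1 + q) powr (- 3 / 2) * flat 1 s / R\<^sup>2\<bar> \<le> 4 * M / R\<^sup>2"
      proof -
        have "q * (1 + q) powr (- 3 / 2) * \<bar>flat 1 s\<bar> \<le> 1 * M"
          using w3 M(1)[OF s] by (intro mult_mono) auto
        then have "q * (1 + q) powr (- 3 / 2) * \<bar>flat 1 s\<bar> / R\<^sup>2 \<le> M / R\<^sup>2" by (intro divide_right_mono) auto
        then show ?thesis using q by (simp add: abs_mult)
      qed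
      have Z: "3 * flat 0 (3 / 4) * 2 powr (- 5 / 2) * indicator (ball 0 1) x
          \<le> 3 * flat 0 s * (1 + q) powr (- 5 / 2)"
      proof (cases "x \<in> ball 0 1")
        case True
        then have q1: "q \<le> 1" unfolding q(2) by (simp add: power_le_one)
        have "4 \<le> R\<^sup>2" using power_mono[OF R, of 2] by simp
        then have "q / R\<^sup>2 \<le> 1 / 4" using q1 q by (intro frac_le) auto
        then have "flat 0 (3 / 4) \<le> flat 0 s" by (intro flat_0_mono) (simp add: s_def)
        moreover have "2 powr (- 5 / 2) \<le> (1 + q) powr (- 5 / 2)"
          using q1 q(1) by (intro powr_mono2') auto
        ultimately have "flat 0 (3 / 4) * 2 powr (- 5 / 2) \<le> flat 0 s * (1 + q) powr (- 5 / 2)"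
          by (intro mult_mono) (auto simp: flat_0_nonneg)
        then show ?thesis using True by simp
      qed (simp add: flat_0_nonneg)
      have combine: "z' - (A + B) \<le> z + X - Y" if "\<bar>X\<bar> \<le> 1 * A" "\<bar>Y\<bar> \<le> B" "z' \<le> z" for X Y z z' A B :: real
        using that by linarith
      have "laplacian (cutoff_barrier R) x \<ge> 3 * flat 0 (3 / 4) * 2 powr (- 5 / 2) * indicator (ball 0 1) x
          - (10 * M / R\<^sup>2 + 4 * M / R\<^sup>2)"
        unfolding lap w_def[symmetric] by (rule combine[OF X Y Z])
      moreover have "10 * M / R\<^sup>2 + 4 * M / R\<^sup>2 = 14 * M / R\<^sup>2"
        by (simp add: add_divide_distrib[symmetric])
      ultimately show ?thesis using True by simp
    qed
  qed
  then show thesis using that[of "14 * M"] \<open>M \<ge> 0\<close> by simp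
qed

lemma integral_positive_on_ball:
  fixes u :: "real ^ 3 \<Rightarrow> real"
  assumes u: "square_integrable u" and pos: "\<And>x. 0 < u x"
  shows "0 < (LINT x|lebesgue. indicator (ball 0 1) x * u x)"
proof -
  have int: "integrable lebesgue (\<lambda>x. indicator (ball 0 1) x * u x)"
    using integrable_scaleR[OF square_integrable_indicator_one u, of "ball 0 1"] by simp
  have nonneg: "0 \<le> indicator (ball 0 1) x * u x" for x
    using pos[of x] by (simp add: indicator_def less_imp_le)
  have "(LINT x|lebesgue. indicator (ball 0 1) x * u x) \<noteq> 0"
  proof
    assume "(LINT x|lebesgue. indicator (ball 0 1) x * u x) = 0"
    then have "AE x in lebesgue. indicator (ball 0 1) x * u x = 0"
      using nonneg by (subst (asm) integral_nonneg_eq_0_iff_AE[OF int]) auto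
    then have "AE x in lebesgue. x \<notin> ball (0 :: real ^ 3) 1"
      by eventually_elim (use pos in \<open>auto simp: indicator_def less_le\<close>)
    then have "ball (0 :: real ^ 3) 1 \<in> null_sets lebesgue"
      by (subst (asm) AE_iff_null_sets[symmetric]) auto
    then have "negligible (ball (0 :: real ^ 3) 1)"
      by (simp add: negligible_iff_null_sets)
    then show False using open_not_negligible[of "ball (0 :: real ^ 3) 1"] by simp
  qed
  moreover have "0 \<le> (LINT x|lebesgue. indicator (ball 0 1) x * u x)"
    using nonneg by (intro integral_nonneg_AE) auto
  ultimately show ?thesis by linarith
qed

text \<open>By the Cauchy--Schwarz inequality the integral of \<open>u\<close> over the ball of radius \<open>R\<close> is of order \<open>R powr (3 / 2)\<close>,
  so the error of order \<open>1 / R\<^sup>2\<close> from the cutoff contributes \<open>R powr (- 1 / 2)\<close> and vanishes in the limit. This forces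
  the integral of \<open>u\<close> over the unit ball to be nonpositive.\<close>
theorem no_positive_superharmonic_H1:
  assumes u: "square_integrable u" "is_weak_gradient u g" and pos: "\<And>x. 0 < u x"
    and super: "\<And>\<psi>. test_function \<psi> \<Longrightarrow> (\<And>x. 0 \<le> \<psi> x) \<Longrightarrow>
      0 \<le> (LINT x|lebesgue. g x \<bullet> gradient \<psi> x)"
  shows False
proof -
  define c where "c = 3 * flat 0 (3 / 4) * 2 powr (- 5 / 2)"
  define m where "m = (LINT x|lebesgue. indicator (ball 0 1) x * u x)"
  have c: "c > 0" unfolding c_def using flat_0_pos[of "3 / 4"] by simp
  obtain M where M: "M \<ge> 0" "\<And>R x. R \<ge> 2 \<Longrightarrow> laplacian (cutoff_barrier R) x \<ge>
       c * indicator (ball 0 1) x - M / R\<^sup>2 * indicator (cball 0 R) x"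
    using laplacian_cutoff_barrier_lower_bound[folded c_def] by blast
  define vol where "vol = measure lebesgue (cball (0 :: real ^ 3) 1)"
  have bound: "c * m \<le> M * l2norm u * sqrt (vol / R)" if R: "R \<ge> 2" for R
  proof -
    have int1: "integrable lebesgue (\<lambda>x. indicator (ball 0 1) x * u x)"
      using integrable_scaleR[OF square_integrable_indicator_one u(1), of "ball 0 1"] by simp
    have int2: "integrable lebesgue (\<lambda>x. indicator (cball 0 R) x * u x)"
      using integrable_scaleR[OF square_integrable_indicator_one u(1), of "cball 0 R"] by simp
    have test: "test_function (cutoff_barrier R)" using R by (intro test_function_cutoff_barrier) simp
    have "c * m - M / R\<^sup>2 * (LINT x|lebesgue. indicator (cball 0 R) x * u x)
        = (LINT x|lebesgue. c * (indicator (ball 0 1) x * u x) - M / R\<^sup>2 * (indicator (cball 0 R) x * u x))"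
      unfolding m_def using int1 int2 by simp
    also have "\<dots> \<le> (LINT x|lebesgue. u x * laplacian (cutoff_barrier R) x)"
    proof (rule integral_mono)
      show "integrable lebesgue (\<lambda>x. u x * laplacian (cutoff_barrier R) x)"
        by (rule integral_laplacian(1)[OF u test])
      show "integrable lebesgue (\<lambda>x. c * (indicator (ball 0 1) x * u x) - M / R\<^sup>2 * (indicator (cball 0 R) x * u x))"
        using int1 int2 by simp
      show "c * (indicator (ball 0 1) x * u x) - M / R\<^sup>2 * (indicator (cball 0 R) x * u x)
          \<le> u x * laplacian (cutoff_barrier R) x" for x
        using mult_left_mono[OF M(2)[OF R, of x], of "u x"] pos[of x] by (simp add: algebra_simps)
    qed
    also have "\<dots> \<le> 0"
      using super[OF test cutoff_barrier_nonneg] integral_laplacian(2)[OF u test] by simp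
    finally have 1: "c * m \<le> M / R\<^sup>2 * (LINT x|lebesgue. indicator (cball 0 R) x * u x)" by simp
    have "(LINT x|lebesgue. indicator (cball 0 R) x * u x) \<le>
        l2norm (indicator (cball 0 R) :: real ^ 3 \<Rightarrow> real) * l2norm u"
      using abs_integral_inner_le[OF square_integrable_indicator_one u(1), of "cball 0 R"] by simp
    also have "l2norm (indicator (cball 0 R) :: real ^ 3 \<Rightarrow> real) = sqrt (vol * R ^ 3)"
    proof -
      have "(LINT x|lebesgue. (norm (indicator (cball (0 :: real ^ 3) R) x :: real))\<^sup>2) =
          (LINT x|lebesgue. indicator (cball (0 :: real ^ 3) R) x)"
        by (intro Bochner_Integration.integral_cong) (auto simp: indicator_def)
      also have "\<dots> = measure lebesgue (cball (0 :: real ^ 3) R)" by simp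
      also have "\<dots> = vol * R ^ 3"
        unfolding vol_def using R content_cball[of R "0 :: real ^ 3"] content_cball[of 1 "0 :: real ^ 3"] by simp
      finally show ?thesis by (simp add: l2norm_def)
    qed
    finally have "M / R\<^sup>2 * (LINT x|lebesgue. indicator (cball 0 R) x * u x)
        \<le> M / R\<^sup>2 * (sqrt (vol * R ^ 3) * l2norm u)"
      using M(1) by (intro mult_left_mono) auto
    also have "sqrt (vol * R ^ 3) = R\<^sup>2 * sqrt (vol / R)"
    proof -
      have "vol * R ^ 3 = (R\<^sup>2)\<^sup>2 * (vol / R)" using R by (simp add: field_simps eval_nat_numeral)
      then have "sqrt (vol * R ^ 3) = sqrt ((R\<^sup>2)\<^sup>2) * sqrt (vol / R)" by (simp only: real_sqrt_mult)
      then show ?thesis by (simp only: real_sqrt_abs abs_power2)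
    qed
    finally show ?thesis using 1 R by (simp add: mult_ac)
  qed
  have "((\<lambda>R. vol / R) \<longlongrightarrow> 0) at_top"
    by (rule tendsto_divide_0[OF tendsto_const filterlim_at_top_imp_at_infinity[OF filterlim_ident]])
  from tendsto_mult_left[OF tendsto_real_sqrt[OF this], of "M * l2norm u"]
  have "((\<lambda>R. M * l2norm u * sqrt (vol / R)) \<longlongrightarrow> M * l2norm u * sqrt 0) at_top" .
  then have "((\<lambda>R. M * l2norm u * sqrt (vol / R)) \<longlongrightarrow> 0) at_top" by simp
  then have "c * m \<le> 0"
  proof (rule tendsto_lowerbound)
    show "\<forall>\<^sub>F R in at_top. c * m \<le> M * l2norm u * sqrt (vol / R)"
      using eventually_ge_at_top[of 2] by eventually_elim (rule bound)
  qed simp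
  moreover have "m > 0" unfolding m_def by (rule integral_positive_on_ball[OF u(1) pos])
  ultimately show False using c by (simp add: mult_le_0_iff)
qed


section \<open>Sums of dispersing bumps\<close>

text \<open>Bumps that escape to infinity, and remainders that are small in \<open>L\<^sup>2\<close>, are invisible to a fixed square
  integrable weight \<open>h\<close>.\<close>
lemma dispersing_remainder_tendsto_0:
  fixes g :: "'i \<Rightarrow> real ^ 3 \<Rightarrow> 'b :: euclidean_space" and h :: "real ^ 3 \<Rightarrow> 'c :: euclidean_space"
  assumes J: "finite J" and g: "\<And>i. i \<in> J \<Longrightarrow> square_integrable (g i)"
    and h: "square_integrable h" and \<gamma>: "\<And>n. square_integrable (\<gamma> n)"
    and z: "\<And>i. i \<in> J \<Longrightarrow> filterlim (\<lambda>n. norm (z i n)) at_top sequentially"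
    and \<gamma>0: "(\<lambda>n. l2norm (\<gamma> n)) \<longlonglongrightarrow> 0"
  shows "(\<lambda>n. LINT x|lebesgue. norm (h x) * norm ((\<Sum>i\<in>J. g i (x + z i n)) + \<gamma> n x)) \<longlonglongrightarrow> 0"
proof -
  let ?G = "\<lambda>n x. (\<Sum>i\<in>J. g i (x + z i n)) + \<gamma> n x"
  have gt: "square_integrable (\<lambda>x. g i (x + z i n))" if "i \<in> J" for i n
    by (rule square_integrable_translate[OF g[OF that]])
  have G: "square_integrable (?G n)" for n
    by (intro square_integrable_add square_integrable_sum gt \<gamma>)
  have "(LINT x|lebesgue. norm (h x) * norm (?G n x)) \<le>
      (\<Sum>i\<in>J. (LINT x|lebesgue. norm (h x) * norm (g i (x + z i n)))) + l2norm h * l2norm (\<gamma> n)" for n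
  proof -
    have "(LINT x|lebesgue. norm (h x) * norm (?G n x)) \<le>
        (LINT x|lebesgue. (\<Sum>i\<in>J. norm (h x) * norm (g i (x + z i n))) + norm (h x) * norm (\<gamma> n x))"
    proof (rule integral_mono)
      fix x
      have "norm (?G n x) \<le> (\<Sum>i\<in>J. norm (g i (x + z i n))) + norm (\<gamma> n x)"
        by (rule norm_triangle_le) (intro add_mono norm_sum order_refl)
      then have "norm (h x) * norm (?G n x) \<le> norm (h x) * ((\<Sum>i\<in>J. norm (g i (x + z i n))) + norm (\<gamma> n x))"
        by (intro mult_left_mono) auto
      then show "norm (h x) * norm (?G n x) \<le> (\<Sum>i\<in>J. norm (h x) * norm (g i (x + z i n))) + norm (h x) * norm (\<gamma> n x)"
        by (simp add: distrib_left sum_distrib_left)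
    qed (intro Bochner_Integration.integrable_add Bochner_Integration.integrable_sum
        integrable_norm_mult_norm h G gt \<gamma>)+
    also have "\<dots> = (LINT x|lebesgue. (\<Sum>i\<in>J. norm (h x) * norm (g i (x + z i n)))) +
        (LINT x|lebesgue. norm (h x) * norm (\<gamma> n x))"
      by (intro Bochner_Integration.integral_add Bochner_Integration.integrable_sum
          integrable_norm_mult_norm h gt \<gamma>)
    also have "(LINT x|lebesgue. (\<Sum>i\<in>J. norm (h x) * norm (g i (x + z i n)))) =
        (\<Sum>i\<in>J. (LINT x|lebesgue. norm (h x) * norm (g i (x + z i n))))"
      by (intro Bochner_Integration.integral_sum integrable_norm_mult_norm h gt)
    finally show ?thesis
      using l2_Cauchy_Schwarz[OF h \<gamma>[of n]] by linarith
  qed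
  then have bound: "norm (LINT x|lebesgue. norm (h x) * norm (?G n x)) \<le>
      (\<Sum>i\<in>J. (LINT x|lebesgue. norm (h x) * norm (g i (x + z i n)))) + l2norm h * l2norm (\<gamma> n)" for n
    by (simp add: integral_nonneg_AE)
  have "(\<lambda>n. (\<Sum>i\<in>J. (LINT x|lebesgue. norm (h x) * norm (g i (x + z i n)))) + l2norm h * l2norm (\<gamma> n))
      \<longlonglongrightarrow> (\<Sum>i\<in>J. 0) + l2norm h * 0"
    by (intro tendsto_add tendsto_sum tendsto_mult tendsto_const \<gamma>0
        integral_translate_product_tendsto_0[OF h g z])
  then have lim: "(\<lambda>n. (\<Sum>i\<in>J. (LINT x|lebesgue. norm (h x) * norm (g i (x + z i n)))) + l2norm h * l2norm (\<gamma> n))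
      \<longlonglongrightarrow> 0" by simp
  show ?thesis
    by (rule Lim_null_comparison[OF always_eventually[OF allI] lim]) (rule bound)
qed

text \<open>The bumps become orthogonal in the limit, so the squared norm of the sum tends to the sum of the
  squared norms, and the remainder enters only through terms bounded by a multiple of its norm.\<close>
lemma energy_of_dispersing_sum:
  fixes g :: "'i \<Rightarrow> real ^ 3 \<Rightarrow> 'b :: euclidean_space"
  assumes I: "finite I" and g: "\<And>i. i \<in> I \<Longrightarrow> square_integrable (g i)"
    and \<gamma>: "\<And>n. square_integrable (\<gamma> n)"
    and z: "\<And>i j. i \<in> I \<Longrightarrow> j \<in> I \<Longrightarrow> i \<noteq> j \<Longrightarrow> filterlim (\<lambda>n. norm (z i n - z j n)) at_top sequentially"
    and \<gamma>0: "(\<lambda>n. l2norm (\<gamma> n)) \<longlonglongrightarrow> 0"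
  shows "(\<lambda>n. (l2norm (\<lambda>x. (\<Sum>i\<in>I. g i (x + z i n)) + \<gamma> n x))\<^sup>2) \<longlonglongrightarrow> (\<Sum>i\<in>I. (l2norm (g i))\<^sup>2)"
proof -
  let ?S = "\<lambda>n x. \<Sum>i\<in>I. g i (x + z i n)"
  let ?c = "\<Sum>i\<in>I. (l2norm (g i))\<^sup>2"
  have gt: "square_integrable (\<lambda>x. g i (x + z i n))" if "i \<in> I" for i n
    by (rule square_integrable_translate[OF g[OF that]])
  have S: "square_integrable (?S n)" for n by (intro square_integrable_sum gt)
  have pair: "(\<lambda>n. LINT x|lebesgue. g i (x + z i n) \<bullet> g j (x + z j n)) \<longlonglongrightarrow>
      (if i = j then (l2norm (g i))\<^sup>2 else 0)" if ij: "i \<in> I" "j \<in> I" for i j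
  proof (cases "i = j")
    case True
    have "(LINT x|lebesgue. g i (x + z i n) \<bullet> g i (x + z i n)) = (l2norm (g i))\<^sup>2" for n
      using l2norm_translate[OF g[OF ij(1)], of "z i n"]
      by (simp add: l2norm_power2 power2_norm_eq_inner[symmetric] flip: l2norm_power2)
    then show ?thesis using True by simp
  next
    case False
    have eq: "(LINT x|lebesgue. norm (g i (x + z i n)) * norm (g j (x + z j n))) =
        (LINT x|lebesgue. norm (g i x) * norm (g j (x + (z j n - z i n))))" for n
    proof -
      have "(\<lambda>x. norm (g i x) * norm (g j (x + (z j n - z i n)))) \<in> borel_measurable lebesgue"
        by (intro borel_measurable_integrable integrable_norm_mult_norm g square_integrable_translate ij)
      from integral_affine[OF this, of 1 "z i n"] show ?thesis
        by (simp add: add.commute add.left_commute)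
    qed
    have "(\<lambda>n. LINT x|lebesgue. norm (g i x) * norm (g j (x + (z j n - z i n)))) \<longlonglongrightarrow> 0"
      using z[OF ij(2,1)] False by (intro integral_translate_product_tendsto_0 g ij) auto
    then have lim: "(\<lambda>n. LINT x|lebesgue. norm (g i (x + z i n)) * norm (g j (x + z j n))) \<longlonglongrightarrow> 0"
      by (simp only: eq)
    have bound: "norm (LINT x|lebesgue. g i (x + z i n) \<bullet> g j (x + z j n)) \<le>
        (LINT x|lebesgue. norm (g i (x + z i n)) * norm (g j (x + z j n)))" for n
      unfolding real_norm_def by (intro abs_integral_inner_le_integral_norm gt ij)
    have "(\<lambda>n. LINT x|lebesgue. g i (x + z i n) \<bullet> g j (x + z j n)) \<longlonglongrightarrow> 0"
      by (rule Lim_null_comparison[OF always_eventually[OF allI] lim]) (rule bound)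
    then show ?thesis using False by simp
  qed
  have Ssq: "(l2norm (?S n))\<^sup>2 = (\<Sum>i\<in>I. \<Sum>j\<in>I. (LINT x|lebesgue. g i (x + z i n) \<bullet> g j (x + z j n)))" for n
  proof -
    have "(norm (?S n x))\<^sup>2 = (\<Sum>i\<in>I. \<Sum>j\<in>I. g i (x + z i n) \<bullet> g j (x + z j n))" for x
      unfolding power2_norm_eq_inner inner_sum_left inner_sum_right by (rule sum.swap)
    then have "(l2norm (?S n))\<^sup>2 = (LINT x|lebesgue. (\<Sum>i\<in>I. \<Sum>j\<in>I. g i (x + z i n) \<bullet> g j (x + z j n)))"
      by (simp only: l2norm_power2)
    also have "\<dots> = (\<Sum>i\<in>I. (LINT x|lebesgue. (\<Sum>j\<in>I. g i (x + z i n) \<bullet> g j (x + z j n))))"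
      by (intro Bochner_Integration.integral_sum Bochner_Integration.integrable_sum integrable_inner gt)
    also have "\<dots> = (\<Sum>i\<in>I. \<Sum>j\<in>I. (LINT x|lebesgue. g i (x + z i n) \<bullet> g j (x + z j n)))"
      by (intro sum.cong refl Bochner_Integration.integral_sum integrable_inner gt)
    finally show ?thesis .
  qed
  have "(\<lambda>n. (l2norm (?S n))\<^sup>2) \<longlonglongrightarrow> (\<Sum>i\<in>I. \<Sum>j\<in>I. if i = j then (l2norm (g i))\<^sup>2 else 0)"
    unfolding Ssq by (intro tendsto_sum pair)
  then have S_lim: "(\<lambda>n. (l2norm (?S n))\<^sup>2) \<longlonglongrightarrow> ?c"
    using I by (simp add: sum.delta)
  have S_lim1: "(\<lambda>n. l2norm (?S n)) \<longlonglongrightarrow> sqrt ?c"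
    using tendsto_real_sqrt[OF S_lim] by (simp add: l2norm_nonneg)
  have cross: "(\<lambda>n. LINT x|lebesgue. ?S n x \<bullet> \<gamma> n x) \<longlonglongrightarrow> 0"
  proof (rule Lim_null_comparison[OF always_eventually[OF allI]])
    show "norm (LINT x|lebesgue. ?S n x \<bullet> \<gamma> n x) \<le> l2norm (?S n) * l2norm (\<gamma> n)" for n
      unfolding real_norm_def by (rule abs_integral_inner_le[OF S \<gamma>])
    show "(\<lambda>n. l2norm (?S n) * l2norm (\<gamma> n)) \<longlonglongrightarrow> 0"
      using tendsto_mult[OF S_lim1 \<gamma>0] by simp
  qed
  have expand: "(l2norm (\<lambda>x. ?S n x + \<gamma> n x))\<^sup>2 =
      (l2norm (?S n))\<^sup>2 + 2 * (LINT x|lebesgue. ?S n x \<bullet> \<gamma> n x) + (l2norm (\<gamma> n))\<^sup>2" for n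
  proof -
    have "(l2norm (\<lambda>x. ?S n x + \<gamma> n x))\<^sup>2 =
        (LINT x|lebesgue. ?S n x \<bullet> ?S n x + 2 * (?S n x \<bullet> \<gamma> n x) + \<gamma> n x \<bullet> \<gamma> n x)"
      unfolding l2norm_power2 power2_norm_eq_inner
      by (intro Bochner_Integration.integral_cong refl) (simp add: inner_add_left inner_add_right inner_commute)
    also have "\<dots> = (LINT x|lebesgue. ?S n x \<bullet> ?S n x) + 2 * (LINT x|lebesgue. ?S n x \<bullet> \<gamma> n x)
        + (LINT x|lebesgue. \<gamma> n x \<bullet> \<gamma> n x)"
      using integrable_inner[OF S S, of n n] integrable_inner[OF S \<gamma>, of n n] integrable_inner[OF \<gamma> \<gamma>, of n n]
      by (simp del: inner_sum_left inner_sum_right)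
    finally show ?thesis by (simp only: l2norm_power2 power2_norm_eq_inner)
  qed
  have "(\<lambda>n. (l2norm (?S n))\<^sup>2 + 2 * (LINT x|lebesgue. ?S n x \<bullet> \<gamma> n x) + (l2norm (\<gamma> n))\<^sup>2)
      \<longlonglongrightarrow> ?c + 2 * 0 + 0\<^sup>2"
    by (intro tendsto_add tendsto_mult tendsto_const S_lim cross tendsto_power \<gamma>0)
  then show ?thesis unfolding expand by simp
qed

section \<open>Rescaling the equation\<close>

text \<open>Test the equation for \<open>u\<close> with the rescaled test function \<open>\<eta>\<close>. Every integral gains a factor \<open>\<epsilon> ^ 3\<close> from the
  change of variables and the two gradients cost \<open>\<epsilon>\<^sup>2\<close>, which cancels the factor in front of \<open>\<alpha>\<close>. The energy of
  \<open>u\<close> is \<open>\<epsilon>\<close> times the energy of the rescaled function, which supplies the missing factor in front of \<open>\<beta>\<close>.\<close>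
lemma kirchhoff_solution_rescale:
  assumes sol: "kirchhoff_solution (\<epsilon>\<^sup>2 * \<alpha>) (\<epsilon> * \<beta>) V p u" and \<epsilon>: "\<epsilon> > 0"
    and V: "V \<in> borel_measurable lebesgue"
  shows "kirchhoff_solution \<alpha> \<beta> (\<lambda>x. V (t + \<epsilon> *\<^sub>R x)) p (\<lambda>x. u (t + \<epsilon> *\<^sub>R x))"
proof -
  have H1: "H1 u" and pos: "\<And>x. 0 < u x" using sol by (auto simp: kirchhoff_solution_def)
  note u = H1_square_integrable[OF H1] H1_weak_gradient[OF H1]
  define g where "g = weak_gradient u"
  have g: "square_integrable g" unfolding g_def by (rule H1_weak_gradient_square_integrable[OF H1])
  have [measurable]: "u \<in> borel_measurable lebesgue" "g \<in> borel_measurable lebesgue"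
    using u(1) g by (auto dest: square_integrable_measurable)
  note [measurable] = V
  let ?v = "\<lambda>x. u (t + \<epsilon> *\<^sub>R x)" and ?h = "\<lambda>x. \<epsilon> *\<^sub>R g (t + \<epsilon> *\<^sub>R x)"
  have \<epsilon>0: "\<epsilon> \<noteq> 0" using \<epsilon> by simp
  have v: "square_integrable ?v" by (rule square_integrable_affine[OF u(1) \<epsilon>0])
  have h: "is_weak_gradient ?v ?h"
    unfolding g_def by (rule is_weak_gradient_affine[OF u \<epsilon>0])
  have energy: "dirichlet_energy u = \<epsilon> * dirichlet_energy ?v"
  proof -
    have "(l2norm ?h)\<^sup>2 = \<epsilon>\<^sup>2 * (l2norm (\<lambda>x. g (t + \<epsilon> *\<^sub>R x)))\<^sup>2"
      by (simp add: l2norm_power2 power_mult_distrib)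
    moreover have "(l2norm g)\<^sup>2 = \<epsilon> ^ 3 * (l2norm (\<lambda>x. g (t + \<epsilon> *\<^sub>R x)))\<^sup>2"
      using l2norm_affine[OF g \<epsilon>0, of t] \<epsilon> by simp
    ultimately show ?thesis
      using dirichlet_energy_eq[OF u] dirichlet_energy_eq[OF v h]
      by (simp add: g_def power3_eq_cube power2_eq_square)
  qed
  show ?thesis
    unfolding kirchhoff_solution_def
  proof (intro conjI allI impI)
    show "H1 ?v" using v h by (auto simp: H1_def)
    show "0 < u (t + \<epsilon> *\<^sub>R x)" for x by (rule pos)
    fix \<psi> :: "real ^ 3 \<Rightarrow> real" assume \<psi>: "test_function \<psi>"
    define \<eta> where "\<eta> = (\<lambda>y. \<psi> (- (1 / \<epsilon>) *\<^sub>R t + (1 / \<epsilon>) *\<^sub>R y))"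
    have \<eta>: "test_function \<eta>" unfolding \<eta>_def using \<psi> \<epsilon> by (intro test_function_affine) auto
    have inv: "- (1 / \<epsilon>) *\<^sub>R t + (1 / \<epsilon>) *\<^sub>R (t + \<epsilon> *\<^sub>R x) = x" for x
      using \<epsilon> by (simp add: algebra_simps)
    have \<eta>1: "\<eta> (t + \<epsilon> *\<^sub>R x) = \<psi> x" for x
      unfolding \<eta>_def inv ..
    have \<eta>2: "gradient \<eta> (t + \<epsilon> *\<^sub>R x) = (1 / \<epsilon>) *\<^sub>R gradient \<psi> x" for x
      unfolding \<eta>_def gradient_affine[OF test_function_smooth[OF \<psi>]] inv ..
    have [measurable]: "\<eta> \<in> borel_measurable lebesgue" "gradient \<eta> \<in> borel_measurable lebesgue"
      using test_function_square_integrable[OF \<eta>] test_function_gradient_square_integrable[OF \<eta>]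
      by (auto dest: square_integrable_measurable)
    have eq: "integrable lebesgue (\<lambda>x. u x powr p * \<eta> x)"
      "(\<epsilon>\<^sup>2 * \<alpha> + \<epsilon> * \<beta> * dirichlet_energy u) * (LINT x|lebesgue. g x \<bullet> gradient \<eta> x)
        + (LINT x|lebesgue. V x * u x * \<eta> x) = (LINT x|lebesgue. u x powr p * \<eta> x)"
      using sol \<eta> unfolding kirchhoff_solution_def g_def by blast+
    have meas: "(\<lambda>x. u x powr p * \<eta> x) \<in> borel_measurable lebesgue" by measurable
    show "integrable lebesgue (\<lambda>x. u (t + \<epsilon> *\<^sub>R x) powr p * \<psi> x)"
      using integrable_affine_iff[OF meas \<epsilon>0, of t] eq(1) by (simp add: \<eta>1)
    have i1: "(LINT x|lebesgue. u x powr p * \<eta> x) = \<epsilon> ^ 3 * (LINT x|lebesgue. ?v x powr p * \<psi> x)"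
      using integral_affine[OF meas \<epsilon>0, of t] \<epsilon> by (simp add: \<eta>1)
    have "(\<lambda>x. V x * u x * \<eta> x) \<in> borel_measurable lebesgue" by measurable
    from integral_affine[OF this \<epsilon>0, of t]
    have i2: "(LINT x|lebesgue. V x * u x * \<eta> x) =
        \<epsilon> ^ 3 * (LINT x|lebesgue. V (t + \<epsilon> *\<^sub>R x) * ?v x * \<psi> x)"
      using \<epsilon> by (simp add: \<eta>1)
    have i3: "\<epsilon>\<^sup>2 * (LINT x|lebesgue. g x \<bullet> gradient \<eta> x) =
        \<epsilon> ^ 3 * (LINT x|lebesgue. weak_gradient ?v x \<bullet> gradient \<psi> x)"
    proof -
      have "(\<lambda>x. g x \<bullet> gradient \<eta> x) \<in> borel_measurable lebesgue" by measurable
      from integral_affine[OF this \<epsilon>0, of t]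
      have "(LINT x|lebesgue. g x \<bullet> gradient \<eta> x) =
          \<epsilon> ^ 3 * (LINT x|lebesgue. (1 / \<epsilon>) * (g (t + \<epsilon> *\<^sub>R x) \<bullet> gradient \<psi> x))"
        using \<epsilon> by (simp add: \<eta>2)
      also have "\<dots> = \<epsilon>\<^sup>2 * (LINT x|lebesgue. g (t + \<epsilon> *\<^sub>R x) \<bullet> gradient \<psi> x)"
        unfolding integral_mult_right_zero using \<epsilon> by (simp add: power3_eq_cube power2_eq_square)
      finally have 1: "(LINT x|lebesgue. g x \<bullet> gradient \<eta> x) =
          \<epsilon>\<^sup>2 * (LINT x|lebesgue. g (t + \<epsilon> *\<^sub>R x) \<bullet> gradient \<psi> x)" .
      have "(LINT x|lebesgue. weak_gradient ?v x \<bullet> gradient \<psi> x) =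
          (LINT x|lebesgue. \<epsilon> * (g (t + \<epsilon> *\<^sub>R x) \<bullet> gradient \<psi> x))"
        using integral_weak_gradient_inner[OF v h test_function_gradient_square_integrable[OF \<psi>]] by simp
      then have 2: "(LINT x|lebesgue. weak_gradient ?v x \<bullet> gradient \<psi> x) =
          \<epsilon> * (LINT x|lebesgue. g (t + \<epsilon> *\<^sub>R x) \<bullet> gradient \<psi> x)"
        unfolding integral_mult_right_zero .
      show ?thesis unfolding 1 2 by (simp add: power3_eq_cube power2_eq_square)
    qed
    have "\<epsilon> ^ 3 * ((\<alpha> + \<beta> * dirichlet_energy ?v) * (LINT x|lebesgue. weak_gradient ?v x \<bullet> gradient \<psi> x)
        + (LINT x|lebesgue. V (t + \<epsilon> *\<^sub>R x) * ?v x * \<psi> x)) =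
      (\<alpha> + \<beta> * dirichlet_energy ?v) * (\<epsilon>\<^sup>2 * (LINT x|lebesgue. g x \<bullet> gradient \<eta> x))
        + (LINT x|lebesgue. V x * u x * \<eta> x)"
      unfolding i2 i3 by (simp add: algebra_simps)
    also have "\<dots> = \<epsilon> ^ 3 * (LINT x|lebesgue. ?v x powr p * \<psi> x)"
      using eq(2) unfolding i1 energy by (simp add: power2_eq_square algebra_simps)
    finally show "(\<alpha> + \<beta> * dirichlet_energy ?v) * (LINT x|lebesgue. weak_gradient ?v x \<bullet> gradient \<psi> x)
        + (LINT x|lebesgue. V (t + \<epsilon> *\<^sub>R x) * ?v x * \<psi> x) = (LINT x|lebesgue. ?v x powr p * \<psi> x)"
      using \<epsilon> by simp
  qed
qed


section \<open>The limit of the rescaled equations\<close>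

text \<open>A positive function of zero energy would be weakly harmonic, in particular weakly superharmonic.\<close>
lemma dirichlet_energy_pos:
  assumes H1: "H1 u" and pos: "\<And>x. 0 < u x"
  shows "0 < dirichlet_energy u"
proof (rule ccontr)
  note u = H1_square_integrable[OF H1] H1_weak_gradient[OF H1]
  note g = H1_weak_gradient_square_integrable[OF H1]
  assume "\<not> 0 < dirichlet_energy u"
  then have "dirichlet_energy u = 0"
    using dirichlet_energy_eq[OF u] zero_le_power2[of "l2norm (weak_gradient u)"] by linarith
  then have norm0: "l2norm (weak_gradient u) = 0"
    using dirichlet_energy_eq[OF u] by simp
  have "0 \<le> (LINT x|lebesgue. weak_gradient u x \<bullet> gradient \<psi> x)" if "test_function \<psi>" for \<psi>
    using abs_integral_inner_le[OF g test_function_gradient_square_integrable[OF that]] norm0 by simp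
  then show False by (rule no_positive_superharmonic_H1[OF u pos])
qed

text \<open>The convergence is weighted by \<open>\<psi>\<close> because \<open>v n\<close> is only controlled on the support of \<open>\<psi>\<close>.\<close>
lemma Fatou_powr_test_function:
  fixes v :: "nat \<Rightarrow> real ^ 3 \<Rightarrow> real"
  assumes lim: "AE x in lebesgue. (\<lambda>n. \<psi> x * (v n x - U x)) \<longlonglongrightarrow> 0"
    and nonneg: "\<And>x. 0 \<le> \<psi> x" "\<And>x. 0 < U x"
    and int: "\<And>n. integrable lebesgue (\<lambda>x. v n x powr p * \<psi> x)"
    and intU: "integrable lebesgue (\<lambda>x. U x powr p * \<psi> x)"
    and L: "(\<lambda>n. LINT x|lebesgue. v n x powr p * \<psi> x) \<longlonglongrightarrow> L"
  shows "(LINT x|lebesgue. U x powr p * \<psi> x) \<le> L"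
proof -
  have pw: "AE x in lebesgue. (\<lambda>n. v n x powr p * \<psi> x) \<longlonglongrightarrow> U x powr p * \<psi> x"
    using lim
  proof eventually_elim
    case (elim x)
    show ?case
    proof (cases "\<psi> x = 0")
      case False
      then have "(\<lambda>n. inverse (\<psi> x) * (\<psi> x * (v n x - U x))) \<longlonglongrightarrow> inverse (\<psi> x) * 0"
        by (intro tendsto_mult tendsto_const elim)
      then have "(\<lambda>n. v n x - U x) \<longlonglongrightarrow> 0"
        using False by (simp add: mult.assoc[symmetric])
      then have "(\<lambda>n. v n x) \<longlonglongrightarrow> U x" by (simp add: LIM_zero_iff)
      then show ?thesis
        using nonneg(2)[of x] by (intro tendsto_mult tendsto_powr tendsto_const) auto
    qed simp
  qed
  have nn: "(\<integral>\<^sup>+x. ennreal (w x powr p * \<psi> x) \<partial>lebesgue) = ennreal (LINT x|lebesgue. w x powr p * \<psi> x)"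
    if "integrable lebesgue (\<lambda>x. w x powr p * \<psi> x)" for w :: "real ^ 3 \<Rightarrow> real"
    using nonneg by (intro nn_integral_eq_integral that) auto
  have "ennreal (LINT x|lebesgue. U x powr p * \<psi> x) =
      (\<integral>\<^sup>+x. liminf (\<lambda>n. ennreal (v n x powr p * \<psi> x)) \<partial>lebesgue)"
    unfolding nn[OF intU, symmetric]
  proof (rule nn_integral_cong_AE)
    show "AE x in lebesgue. ennreal (U x powr p * \<psi> x) = liminf (\<lambda>n. ennreal (v n x powr p * \<psi> x))"
      using pw by eventually_elim (intro lim_imp_Liminf[symmetric] tendsto_ennrealI, auto)
  qed
  also have "\<dots> \<le> liminf (\<lambda>n. \<integral>\<^sup>+x. ennreal (v n x powr p * \<psi> x) \<partial>lebesgue)"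
    using int by (intro nn_integral_liminf) (simp add: borel_measurable_integrable)
  also have "\<dots> = liminf (\<lambda>n. ennreal (LINT x|lebesgue. v n x powr p * \<psi> x))"
    unfolding nn[OF int] ..
  also have "\<dots> = ennreal L"
    by (intro lim_imp_Liminf tendsto_ennrealI L) simp
  finally have *: "ennreal (LINT x|lebesgue. U x powr p * \<psi> x) \<le> ennreal L" .
  have "0 \<le> L"
    using nonneg by (intro LIMSEQ_le_const[OF L]) (auto intro!: integral_nonneg_AE)
  then show ?thesis using * by simp
qed

text \<open>The core of the argument, in rescaled variables. The bump \<open>U k\<close> stays at the origin and the others move away
  from it and from each other. Passing to the limit in the equation yields a second relation for \<open>U k\<close>, whose
  coefficient contains the energy of all bumps instead of that of \<open>U k\<close> alone.\<close>
lemma no_dispersing_solutions: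
  fixes U :: "'i \<Rightarrow> real ^ 3 \<Rightarrow> real" and \<phi> v W :: "nat \<Rightarrow> real ^ 3 \<Rightarrow> real"
  assumes b: "b > 0" and I: "finite I" "k \<in> I" "l \<in> I" "k \<noteq> l"
    and U: "\<And>i. i \<in> I \<Longrightarrow> H1 (U i)" "\<And>i x. i \<in> I \<Longrightarrow> 0 < U i x"
    and solU: "kirchhoff_solution a b (\<lambda>_. w) p (U k)"
    and z: "\<And>i j. i \<in> I \<Longrightarrow> j \<in> I \<Longrightarrow> i \<noteq> j \<Longrightarrow> filterlim (\<lambda>n. norm (z i n - z j n)) at_top sequentially"
    and zk: "\<And>n. z k n = 0"
    and \<phi>: "\<And>n. H1 (\<phi> n)" "(\<lambda>n. l2norm (\<phi> n)) \<longlonglongrightarrow> 0" "(\<lambda>n. dirichlet_energy (\<phi> n)) \<longlonglongrightarrow> 0"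
    and v: "\<And>n x. v n x = (\<Sum>i\<in>I. U i (x + z i n)) + \<phi> n x"
    and W: "\<And>n. W n \<in> borel_measurable lebesgue" "\<And>n x. \<bar>W n x\<bar> \<le> M" "\<And>x. (\<lambda>n. W n x) \<longlonglongrightarrow> w"
    and sol: "\<And>n. kirchhoff_solution a b (W n) p (v n)"
  shows False
proof -
  define g where "g i = weak_gradient (U i)" for i
  define \<gamma> where "\<gamma> n = weak_gradient (\<phi> n)" for n
  define J where "J = I - {k}"
  have J: "finite J" "I = insert k J" "k \<notin> J" "\<And>i. i \<in> J \<Longrightarrow> i \<in> I" using I by (auto simp: J_def)
  have zJ: "filterlim (\<lambda>n. norm (z i n)) at_top sequentially" if "i \<in> J" for i
    using z[of i k] that I by (simp add: J_def zk)
  have siU: "square_integrable (U i)" and wgU: "is_weak_gradient (U i) (g i)" and sig: "square_integrable (g i)"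
    if "i \<in> I" for i
    using U(1)[OF that] by (simp_all add: g_def H1_square_integrable H1_weak_gradient H1_weak_gradient_square_integrable)
  have si\<phi>: "square_integrable (\<phi> n)" and wg\<phi>: "is_weak_gradient (\<phi> n) (\<gamma> n)" and si\<gamma>: "square_integrable (\<gamma> n)" for n
    using \<phi>(1)[of n] by (simp_all add: \<gamma>_def H1_square_integrable H1_weak_gradient H1_weak_gradient_square_integrable)
  have \<gamma>0: "(\<lambda>n. l2norm (\<gamma> n)) \<longlonglongrightarrow> 0"
    using tendsto_real_sqrt[OF \<phi>(3)] dirichlet_energy_eq[OF si\<phi> wg\<phi>] by (simp add: l2norm_nonneg)
  have siUt: "square_integrable (\<lambda>x. U i (x + z i n))" and sigt: "square_integrable (\<lambda>x. g i (x + z i n))"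
    if "i \<in> I" for i n
    by (intro square_integrable_translate siU sig that)+
  have wgt: "is_weak_gradient (\<lambda>x. U i (x + z i n)) (\<lambda>x. g i (x + z i n))" if "i \<in> I" for i n
    using is_weak_gradient_affine[OF siU[OF that] wgU[OF that], of 1 "z i n"] by (simp add: add.commute)
  define G where "G n x = (\<Sum>i\<in>I. g i (x + z i n)) + \<gamma> n x" for n x
  have siv: "square_integrable (v n)" for n
    unfolding v[abs_def] by (intro square_integrable_add square_integrable_sum siUt si\<phi>)
  have siG: "square_integrable (G n)" for n
    unfolding G_def[abs_def] by (intro square_integrable_add square_integrable_sum sigt si\<gamma>)
  have wgv: "is_weak_gradient (v n) (G n)" for n
    unfolding v[abs_def] G_def[abs_def]
    by (intro is_weak_gradient_add square_integrable_sum siUt si\<phi> wg\<phi> is_weak_gradient_sum I conjI wgt)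
  define D where "D = (\<Sum>i\<in>I. dirichlet_energy (U i))"
  have energy: "(\<lambda>n. dirichlet_energy (v n)) \<longlonglongrightarrow> D"
  proof -
    have "(\<lambda>n. (l2norm (G n))\<^sup>2) \<longlonglongrightarrow> (\<Sum>i\<in>I. (l2norm (g i))\<^sup>2)"
      unfolding G_def[abs_def] 
    proof (rule energy_of_dispersing_sum[where g = g and z = z and \<gamma> = \<gamma> and I = I])
      show "finite I" by (rule I(1))
      show "square_integrable (g i)" if "i \<in> I" for i by (rule sig[OF that])
      show "square_integrable (\<gamma> n)" for n by (rule si\<gamma>)
      show "filterlim (\<lambda>n. norm (z i n - z j n)) at_top sequentially"
        if "i \<in> I" "j \<in> I" "i \<noteq> j" for i j by (rule z[OF that])
      show "(\<lambda>n. l2norm (\<gamma> n)) \<longlonglongrightarrow> 0" by (rule \<gamma>0)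
    qed
    moreover have "(l2norm (G n))\<^sup>2 = dirichlet_energy (v n)" for n
      by (rule dirichlet_energy_eq[OF siv wgv, symmetric])
    moreover have "(\<Sum>i\<in>I. (l2norm (g i))\<^sup>2) = D"
      unfolding D_def by (intro sum.cong refl dirichlet_energy_eq[symmetric] siU wgU)
    ultimately show ?thesis by (simp only:)
  qed
  have D: "dirichlet_energy (U k) < D"
  proof -
    have "0 < (\<Sum>i\<in>J. dirichlet_energy (U i))"
    proof (rule sum_pos2)
      show "finite J" by (rule J(1))
      show "l \<in> J" using I(3,4) by (simp add: J_def)
      show "0 < dirichlet_energy (U l)"
        using I(3) by (intro dirichlet_energy_pos U)
      show "0 \<le> dirichlet_energy (U i)" if "i \<in> J" for i
        using dirichlet_energy_pos[OF U[OF J(4)[OF that]]] by simp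
    qed
    then show ?thesis using J by (simp add: D_def)
  qed
  have "0 \<le> (LINT x|lebesgue. g k x \<bullet> gradient \<psi> x)" if \<psi>: "test_function \<psi>" "\<And>x. 0 \<le> \<psi> x" for \<psi>
  proof -
    note si\<psi> = test_function_square_integrable[OF \<psi>(1)] test_function_gradient_square_integrable[OF \<psi>(1)]
    have [measurable]: "\<psi> \<in> borel_measurable lebesgue" by (rule square_integrable_measurable[OF si\<psi>(1)])
    have [measurable]: "U k \<in> borel_measurable lebesgue" by (rule square_integrable_measurable[OF siU[OF I(2)]])
    have [measurable]: "v n \<in> borel_measurable lebesgue" for n by (rule square_integrable_measurable[OF siv])
    note [measurable] = W(1)
    have M: "M \<ge> 0" using W(2)[of 0 0] by linarith
    have vU: "v n x - U k x = (\<Sum>i\<in>J. U i (x + z i n)) + \<phi> n x" for n x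
      unfolding v using J by (simp add: zk)
    have Gg: "G n x - g k x = (\<Sum>i\<in>J. g i (x + z i n)) + \<gamma> n x" for n x
      unfolding G_def using J by (simp add: zk)
    have remU: "(\<lambda>n. LINT x|lebesgue. norm (\<psi> x) * norm (v n x - U k x)) \<longlonglongrightarrow> 0"
      unfolding vU by (intro dispersing_remainder_tendsto_0 J siU si\<psi> si\<phi> zJ \<phi>)
    have remg: "(\<lambda>n. LINT x|lebesgue. norm (gradient \<psi> x) * norm (G n x - g k x)) \<longlonglongrightarrow> 0"
      unfolding Gg by (intro dispersing_remainder_tendsto_0 J sig si\<psi> si\<gamma> zJ \<gamma>0)
    have sivU: "square_integrable (\<lambda>x. v n x - U k x)" for n
      by (intro square_integrable_diff siv siU I)
    have siGg: "square_integrable (\<lambda>x. G n x - g k x)" for n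
      by (intro square_integrable_diff siG sig I)
    have grad: "(\<lambda>n. LINT x|lebesgue. weak_gradient (v n) x \<bullet> gradient \<psi> x) \<longlonglongrightarrow>
        (LINT x|lebesgue. g k x \<bullet> gradient \<psi> x)"
    proof (rule Lim_transform)
      show "(\<lambda>n. LINT x|lebesgue. g k x \<bullet> gradient \<psi> x) \<longlonglongrightarrow> (LINT x|lebesgue. g k x \<bullet> gradient \<psi> x)"
        by (rule tendsto_const)
      have bound: "norm ((LINT x|lebesgue. weak_gradient (v n) x \<bullet> gradient \<psi> x) - (LINT x|lebesgue. g k x \<bullet> gradient \<psi> x))
          \<le> (LINT x|lebesgue. norm (gradient \<psi> x) * norm (G n x - g k x))" for n
      proof -
        have "(LINT x|lebesgue. weak_gradient (v n) x \<bullet> gradient \<psi> x) - (LINT x|lebesgue. g k x \<bullet> gradient \<psi> x)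
            = (LINT x|lebesgue. G n x \<bullet> gradient \<psi> x - g k x \<bullet> gradient \<psi> x)"
          unfolding integral_weak_gradient_inner[OF siv wgv si\<psi>(2)]
          by (intro Bochner_Integration.integral_diff[symmetric] integrable_inner siG sig I si\<psi>)
        also have "\<dots> = (LINT x|lebesgue. gradient \<psi> x \<bullet> (G n x - g k x))"
          by (simp add: inner_diff_left inner_diff_right inner_commute)
        finally show ?thesis
          using abs_integral_inner_le_integral_norm[OF si\<psi>(2) siGg] by simp
      qed
      show "(\<lambda>n. (LINT x|lebesgue. weak_gradient (v n) x \<bullet> gradient \<psi> x) - (LINT x|lebesgue. g k x \<bullet> gradient \<psi> x)) \<longlonglongrightarrow> 0"
        by (rule Lim_null_comparison[OF always_eventually[OF allI] remg]) (rule bound)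
    qed
    have siW: "square_integrable (\<lambda>x. W n x * f x)" if "square_integrable f" for n and f :: "real ^ 3 \<Rightarrow> real"
    proof (rule square_integrable_bound)
      show "square_integrable (\<lambda>x. M *\<^sub>R f x)" by (rule square_integrable_scaleR[OF that])
      have [measurable]: "f \<in> borel_measurable lebesgue" by (rule square_integrable_measurable[OF that])
      show "(\<lambda>x. W n x * f x) \<in> borel_measurable lebesgue" by measurable
      show "norm (W n x * f x) \<le> norm (M *\<^sub>R f x)" for x
        using W(2)[of n x] M by (simp add: abs_mult mult_right_mono)
    qed
    have potU: "(\<lambda>n. LINT x|lebesgue. W n x * U k x * \<psi> x) \<longlonglongrightarrow> (LINT x|lebesgue. w * U k x * \<psi> x)"
    proof (rule integral_dominated_convergence[where w = "\<lambda>x. M * (norm (U k x) * norm (\<psi> x))"])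
      show "integrable lebesgue (\<lambda>x. M * (norm (U k x) * norm (\<psi> x)))"
        by (intro integrable_mult_right integrable_norm_mult_norm siU si\<psi> I)
      show "AE x in lebesgue. (\<lambda>n. W n x * U k x * \<psi> x) \<longlonglongrightarrow> w * U k x * \<psi> x"
        by (intro AE_I2 tendsto_mult tendsto_const W)
      show "AE x in lebesgue. norm (W n x * U k x * \<psi> x) \<le> M * (norm (U k x) * norm (\<psi> x))" for n
        using W(2)[of n] by (intro AE_I2) (simp add: abs_mult mult.assoc mult_right_mono)
    qed measurable
    have pot: "(\<lambda>n. LINT x|lebesgue. W n x * v n x * \<psi> x) \<longlonglongrightarrow> (LINT x|lebesgue. w * U k x * \<psi> x)"
    proof (rule Lim_transform[OF potU])
      have bound: "norm ((LINT x|lebesgue. W n x * v n x * \<psi> x) - (LINT x|lebesgue. W n x * U k x * \<psi> x))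
          \<le> M * (LINT x|lebesgue. norm (\<psi> x) * norm (v n x - U k x))" for n
      proof -
        have "(LINT x|lebesgue. W n x * v n x * \<psi> x) - (LINT x|lebesgue. W n x * U k x * \<psi> x)
            = (LINT x|lebesgue. W n x * v n x * \<psi> x - W n x * U k x * \<psi> x)"
          using integrable_inner[OF siW[OF siv] si\<psi>(1)] integrable_inner[OF siW[OF siU[OF I(2)]] si\<psi>(1)]
          by (intro Bochner_Integration.integral_diff[symmetric]) simp_all
        also have "\<dots> = (LINT x|lebesgue. W n x * (\<psi> x * (v n x - U k x)))"
          by (simp add: algebra_simps)
        also have "norm \<dots> \<le> (LINT x|lebesgue. M * (norm (\<psi> x) * norm (v n x - U k x)))"
        proof (rule order_trans[OF integral_norm_bound integral_mono])
          show "integrable lebesgue (\<lambda>x. norm (W n x * (\<psi> x * (v n x - U k x))))"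
            using integrable_norm[OF integrable_inner[OF siW[OF si\<psi>(1)] sivU, of n n]] by (simp add: mult.assoc)
          show "integrable lebesgue (\<lambda>x. M * (norm (\<psi> x) * norm (v n x - U k x)))"
            by (intro integrable_mult_right integrable_norm_mult_norm si\<psi> sivU)
          show "norm (W n x * (\<psi> x * (v n x - U k x))) \<le> M * (norm (\<psi> x) * norm (v n x - U k x))" for x
            using W(2)[of n x] by (simp add: abs_mult mult_right_mono)
        qed
        finally show ?thesis by simp
      qed
      have "(\<lambda>n. M * (LINT x|lebesgue. norm (\<psi> x) * norm (v n x - U k x))) \<longlonglongrightarrow> M * 0"
        by (intro tendsto_mult tendsto_const remU)
      then have lim: "(\<lambda>n. M * (LINT x|lebesgue. norm (\<psi> x) * norm (v n x - U k x))) \<longlonglongrightarrow> 0" by simp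
      show "(\<lambda>n. (LINT x|lebesgue. W n x * v n x * \<psi> x) - (LINT x|lebesgue. W n x * U k x * \<psi> x)) \<longlonglongrightarrow> 0"
        by (rule Lim_null_comparison[OF always_eventually[OF allI] lim]) (rule bound)
    qed
    let ?A = "LINT x|lebesgue. g k x \<bullet> gradient \<psi> x" and ?P = "LINT x|lebesgue. w * U k x * \<psi> x"
    have "integrable lebesgue (\<lambda>x. v n x powr p * \<psi> x) \<and>
        (a + b * dirichlet_energy (v n)) * (LINT x|lebesgue. weak_gradient (v n) x \<bullet> gradient \<psi> x)
        + (LINT x|lebesgue. W n x * v n x * \<psi> x) = (LINT x|lebesgue. v n x powr p * \<psi> x)" for n
      using sol[of n] \<psi>(1) unfolding kirchhoff_solution_def by blast
    then have intv: "integrable lebesgue (\<lambda>x. v n x powr p * \<psi> x)"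
      and eqn: "(a + b * dirichlet_energy (v n)) * (LINT x|lebesgue. weak_gradient (v n) x \<bullet> gradient \<psi> x)
        + (LINT x|lebesgue. W n x * v n x * \<psi> x) = (LINT x|lebesgue. v n x powr p * \<psi> x)" for n
      by blast+
    have "integrable lebesgue (\<lambda>x. U k x powr p * \<psi> x) \<and>
        (a + b * dirichlet_energy (U k)) * ?A + ?P = (LINT x|lebesgue. U k x powr p * \<psi> x)"
      using solU \<psi>(1) unfolding kirchhoff_solution_def g_def by blast
    then have intU: "integrable lebesgue (\<lambda>x. U k x powr p * \<psi> x)"
      and eqU: "(a + b * dirichlet_energy (U k)) * ?A + ?P = (LINT x|lebesgue. U k x powr p * \<psi> x)"
      by blast+
    have "(\<lambda>n. (a + b * dirichlet_energy (v n)) * (LINT x|lebesgue. weak_gradient (v n) x \<bullet> gradient \<psi> x)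
        + (LINT x|lebesgue. W n x * v n x * \<psi> x)) \<longlonglongrightarrow> (a + b * D) * ?A + ?P"
      by (intro tendsto_add tendsto_mult tendsto_const energy grad pot)
    then have lim: "(\<lambda>n. LINT x|lebesgue. v n x powr p * \<psi> x) \<longlonglongrightarrow> (a + b * D) * ?A + ?P"
      unfolding eqn .
    \<comment> \<open>Fatou's lemma needs pointwise convergence, which \<open>L\<^sup>1\<close> convergence provides along a subsequence.\<close>
    have "\<exists>r :: nat \<Rightarrow> nat. strict_mono r \<and> (AE x in lebesgue. (\<lambda>n. \<psi> x * (v (r n) x - U k x)) \<longlonglongrightarrow> 0)"
    proof (rule tendsto_L1_AE_subseq)
      show "integrable lebesgue (\<lambda>x. \<psi> x * (v n x - U k x))" for n
        using integrable_scaleR[OF si\<psi>(1) sivU] by simp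
      show "(\<lambda>n. LINT x|lebesgue. norm (\<psi> x * (v n x - U k x))) \<longlonglongrightarrow> 0"
        using remU by (simp add: abs_mult)
    qed
    then obtain r :: "nat \<Rightarrow> nat" where r: "strict_mono r"
      "AE x in lebesgue. (\<lambda>n. \<psi> x * (v (r n) x - U k x)) \<longlonglongrightarrow> 0"
      by (elim exE conjE)
    have "(LINT x|lebesgue. U k x powr p * \<psi> x) \<le> (a + b * D) * ?A + ?P"
    proof (rule Fatou_powr_test_function[OF r(2)])
      show "0 \<le> \<psi> x" "0 < U k x" for x using \<psi>(2) U(2)[OF I(2)] by auto
      show "integrable lebesgue (\<lambda>x. v (r n) x powr p * \<psi> x)" for n by (rule intv)
      show "integrable lebesgue (\<lambda>x. U k x powr p * \<psi> x)" by (rule intU)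
      show "(\<lambda>n. LINT x|lebesgue. v (r n) x powr p * \<psi> x) \<longlonglongrightarrow> (a + b * D) * ?A + ?P"
        using LIMSEQ_subseq_LIMSEQ[OF lim r(1)] by (simp only: o_def)
    qed
    \<comment> \<open>The potential terms of the two relations for \<open>U k\<close> agree and cancel.\<close>
    then have "(a + b * dirichlet_energy (U k)) * ?A \<le> (a + b * D) * ?A"
      unfolding eqU[symmetric] by (rule add_le_imp_le_right)
    then have "0 \<le> b * (D - dirichlet_energy (U k)) * ?A"
      by (simp add: algebra_simps)
    moreover have "0 < b * (D - dirichlet_energy (U k))" using b D by simp
    ultimately show ?thesis by (simp only: zero_le_mult_iff) linarith
  qed
  then show False
    by (rule no_positive_superharmonic_H1[OF siU[OF I(2)] wgU[OF I(2)] U(2)[OF I(2)]])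
qed

lemma eventually_at_right_0_sequence:
  assumes "\<forall>\<^sub>F \<epsilon> in at_right (0 :: real). P \<epsilon>"
  shows "\<exists>e. (\<forall>n. e n > 0 \<and> P (e n)) \<and> filterlim e (at_right 0) sequentially"
proof -
  obtain d where d: "d > 0" "\<And>\<epsilon>. 0 < \<epsilon> \<Longrightarrow> \<epsilon> < d \<Longrightarrow> P \<epsilon>"
    using assms by (auto simp: eventually_at_right_field)
  define e where "e n = d * inverse (real (Suc (Suc n)))" for n
  have pos: "e n > 0" for n using d by (simp add: e_def)
  have nonzero: "e n \<noteq> 0" for n using pos[of n] by simp
  have "e n < d" for n
  proof -
    have "inverse (real (Suc (Suc n))) < 1" by (rule inverse_less_1_iff[THEN iffD2]) simp
    then show ?thesis using mult_strict_left_mono[of "inverse (real (Suc (Suc n)))" 1 d] d(1) by (simp add: e_def)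
  qed
  then have "P (e n)" for n using d pos by blast
  moreover have "e \<longlonglongrightarrow> d * 0"
    unfolding e_def[abs_def] by (intro tendsto_mult tendsto_const LIMSEQ_Suc[OF LIMSEQ_inverse_real_of_nat])
  then have "filterlim e (at_right 0) sequentially"
    unfolding filterlim_at using pos nonzero by simp
  ultimately show ?thesis using pos by blast
qed

section \<open>Back to the original variables\<close>
lemma eps_norm_bounds:
  assumes V: "V \<in> borel_measurable lebesgue" "bounded (range V)" "\<And>x. c \<le> V x" "c > 0"
    and a: "a > 0" and \<phi>: "H1 \<phi>"
  shows "\<epsilon>\<^sup>2 * a * dirichlet_energy \<phi> \<le> (eps_norm a V \<epsilon> \<phi>)\<^sup>2"
    and "c * (l2norm \<phi>)\<^sup>2 \<le> (eps_norm a V \<epsilon> \<phi>)\<^sup>2"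
proof -
  obtain M where M: "\<And>x. \<bar>V x\<bar> \<le> M" using V(2) by (auto simp: bounded_iff)
  have Vpos: "0 \<le> V x" for x using V(3,4) by (meson less_imp_le order_trans)
  have [measurable]: "\<phi> \<in> borel_measurable lebesgue" "V \<in> borel_measurable lebesgue"
    using V(1) H1_square_integrable[OF \<phi>] by (auto dest: square_integrable_measurable)
  have int\<phi>: "integrable lebesgue (\<lambda>x. (\<phi> x)\<^sup>2)"
    using H1_square_integrable[OF \<phi>] by (simp add: square_integrable_def)
  have intV: "integrable lebesgue (\<lambda>x. V x * (\<phi> x)\<^sup>2)"
  proof (rule Bochner_Integration.integrable_bound)
    show "integrable lebesgue (\<lambda>x. M * (\<phi> x)\<^sup>2)" using int\<phi> by simp
    show "AE x in lebesgue. norm (V x * (\<phi> x)\<^sup>2) \<le> norm (M * (\<phi> x)\<^sup>2)"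
    proof (rule AE_I2)
      fix x
      have "\<bar>V x\<bar> \<le> \<bar>M\<bar>" using M[of x] by linarith
      then show "norm (V x * (\<phi> x)\<^sup>2) \<le> norm (M * (\<phi> x)\<^sup>2)" by (simp add: abs_mult mult_right_mono)
    qed
  qed measurable
  have intg: "integrable lebesgue (\<lambda>x. \<epsilon>\<^sup>2 * a * (norm (weak_gradient \<phi> x))\<^sup>2)"
    using H1_weak_gradient_square_integrable[OF \<phi>] by (simp add: square_integrable_def)
  have nonneg: "0 \<le> \<epsilon>\<^sup>2 * a * (norm (weak_gradient \<phi> x))\<^sup>2" "0 \<le> V x * (\<phi> x)\<^sup>2" for x
    using a Vpos by simp_all
  have "0 \<le> (LINT x|lebesgue. \<epsilon>\<^sup>2 * a * (norm (weak_gradient \<phi> x))\<^sup>2 + V x * (\<phi> x)\<^sup>2)"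
    using nonneg by (intro integral_nonneg_AE) (auto intro!: add_nonneg_nonneg)
  then have eq: "(eps_norm a V \<epsilon> \<phi>)\<^sup>2 = (LINT x|lebesgue. \<epsilon>\<^sup>2 * a * (norm (weak_gradient \<phi> x))\<^sup>2 + V x * (\<phi> x)\<^sup>2)"
    by (simp add: eps_norm_def)
  have "(LINT x|lebesgue. \<epsilon>\<^sup>2 * a * (norm (weak_gradient \<phi> x))\<^sup>2) \<le> (eps_norm a V \<epsilon> \<phi>)\<^sup>2"
    unfolding eq using intg intV nonneg by (intro integral_mono) auto
  then show "\<epsilon>\<^sup>2 * a * dirichlet_energy \<phi> \<le> (eps_norm a V \<epsilon> \<phi>)\<^sup>2"
    by (simp add: dirichlet_energy_def)
  have "(LINT x|lebesgue. c * (\<phi> x)\<^sup>2) \<le> (eps_norm a V \<epsilon> \<phi>)\<^sup>2"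
    unfolding eq
  proof (intro integral_mono)
    show "c * (\<phi> x)\<^sup>2 \<le> \<epsilon>\<^sup>2 * a * (norm (weak_gradient \<phi> x))\<^sup>2 + V x * (\<phi> x)\<^sup>2" for x
      using nonneg(1)[of x] mult_right_mono[OF V(3)[of x], of "(\<phi> x)\<^sup>2"] by simp
  qed (use intg intV int\<phi> in auto)
  then show "c * (l2norm \<phi>)\<^sup>2 \<le> (eps_norm a V \<epsilon> \<phi>)\<^sup>2"
    by (simp add: l2norm_power2)
qed

theorem proposition2p2:
  fixes a b p :: real and k :: nat
    and V :: "real ^ 3 \<Rightarrow> real"
    and A :: "nat \<Rightarrow> real ^ 3"
    and U :: "nat \<Rightarrow> real ^ 3 \<Rightarrow> real"
  assumes "a > 0" and "b > 0" and "1 < p" and "p < 5" and "k \<ge> 2"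
    and "continuous_on UNIV V" and "bounded (range V)"
    and "V1 V" and "V2 k A V"
    and "\<And>i. i \<in> {1..k} \<Longrightarrow> kirchhoff_solution a b (\<lambda>_. V (A i)) p (U i) \<and> radial (U i)"
  shows "\<not> (\<exists>(u :: real \<Rightarrow> real ^ 3 \<Rightarrow> real) (y :: nat \<Rightarrow> real \<Rightarrow> real ^ 3)
              (\<phi> :: real \<Rightarrow> real ^ 3 \<Rightarrow> real).
            k_peak_solution a b p V k u \<and>
            (\<forall>i\<in>{1..k}. (y i \<longlongrightarrow> A i) (at_right 0)) \<and>
            (\<forall>\<^sub>F \<epsilon> in at_right 0. H1 (\<phi> \<epsilon>) \<and>
              (\<forall>x. u \<epsilon> x = (\<Sum>i=1..k. U i ((1 / \<epsilon>) *\<^sub>R (x - y i \<epsilon>))) + \<phi> \<epsilon> x)) \<and>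
            (\<lambda>\<epsilon>. eps_norm a V \<epsilon> (\<phi> \<epsilon>)) \<in> o[at_right 0](\<lambda>\<epsilon>. \<epsilon> powr (3 / 2)))"
proof (intro notI, elim exE conjE)
  fix u y \<phi>
  assume peak: "k_peak_solution a b p V k u"
    and y: "\<forall>i\<in>{1..k}. (y i \<longlongrightarrow> A i) (at_right 0)"
    and decomp: "\<forall>\<^sub>F \<epsilon> in at_right 0. H1 (\<phi> \<epsilon>) \<and>
              (\<forall>x. u \<epsilon> x = (\<Sum>i=1..k. U i ((1 / \<epsilon>) *\<^sub>R (x - y i \<epsilon>))) + \<phi> \<epsilon> x)"
    and small: "(\<lambda>\<epsilon>. eps_norm a V \<epsilon> (\<phi> \<epsilon>)) \<in> o[at_right 0](\<lambda>\<epsilon>. \<epsilon> powr (3 / 2))"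
  have solU: "kirchhoff_solution a b (\<lambda>_. V (A i)) p (U i)" if "i \<in> {1..k}" for i
    using assms(10)[OF that] by blast
  have one: "1 \<in> {1..k}" and two: "2 \<in> {1..k}" using \<open>k \<ge> 2\<close> by auto
  have "inj_on A {1..k}" using \<open>V2 k A V\<close> by (simp add: V2_def)
  have V_meas: "V \<in> borel_measurable lebesgue" using \<open>V1 V\<close> by (simp add: V1_def)
  obtain M where M: "\<And>x. \<bar>V x\<bar> \<le> M" using \<open>bounded (range V)\<close> by (auto simp: bounded_iff)
  define c where "c = (INF x. V x)"
  have c: "c > 0" using \<open>V1 V\<close> by (simp add: V1_def c_def)
  have Vc: "c \<le> V x" for x
    unfolding c_def by (intro cINF_lower bounded_imp_bdd_below \<open>bounded (range V)\<close>) simp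
  have "\<forall>\<^sub>F \<epsilon> in at_right 0. kirchhoff_solution (\<epsilon>\<^sup>2 * a) (\<epsilon> * b) V p (u \<epsilon>)"
    using peak unfolding k_peak_solution_def by blast
  from eventually_at_right_0_sequence[OF eventually_conj[OF this decomp]]
  obtain e where e_all: "\<forall>n. e n > 0 \<and> kirchhoff_solution ((e n)\<^sup>2 * a) (e n * b) V p (u (e n)) \<and>
        H1 (\<phi> (e n)) \<and> (\<forall>x. u (e n) x = (\<Sum>i=1..k. U i ((1 / e n) *\<^sub>R (x - y i (e n)))) + \<phi> (e n) x)"
    and e_lim: "filterlim e (at_right 0) sequentially"
    by (elim exE conjE)
  have e: "e n > 0" and sol: "kirchhoff_solution ((e n)\<^sup>2 * a) (e n * b) V p (u (e n))"
    and \<phi>: "H1 (\<phi> (e n))"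
    and u_eq: "u (e n) x = (\<Sum>i=1..k. U i ((1 / e n) *\<^sub>R (x - y i (e n)))) + \<phi> (e n) x" for n x
    using spec[OF e_all, of n] by simp_all
  have e0: "e n \<noteq> 0" for n using e[of n] by simp
  have e_tendsto: "e \<longlonglongrightarrow> 0" using e_lim by (simp add: filterlim_at)
  have y_lim: "(\<lambda>n. y i (e n)) \<longlonglongrightarrow> A i" if "i \<in> {1..k}" for i
    by (rule filterlim_compose[OF bspec[OF y that] e_lim])
  \<comment> \<open>By assumption \<open>q\<close> tends to 0; its square controls both parts of the rescaled remainder \<open>\<Phi>\<close>.\<close>
  define q where "q n = eps_norm a V (e n) (\<phi> (e n)) / e n powr (3 / 2)" for n
  have q: "q \<longlonglongrightarrow> 0"
    unfolding q_def[abs_def] by (rule filterlim_compose[OF smalloD_tendsto[OF small] e_lim])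
  have q2: "(eps_norm a V (e n) (\<phi> (e n)))\<^sup>2 = (q n)\<^sup>2 * e n ^ 3" for n
  proof -
    have "(e n powr (3 / 2))\<^sup>2 = e n ^ 3"
      using e[of n] by (simp add: power2_eq_square flip: powr_add)
    then show ?thesis using e[of n] by (simp add: q_def power_divide)
  qed
  define t where "t n = y 1 (e n)" for n
  define z where "z i n = (1 / e n) *\<^sub>R (y 1 (e n) - y i (e n))" for i n
  define \<Phi> where "\<Phi> n x = \<phi> (e n) (t n + e n *\<^sub>R x)" for n x
  note si\<phi> = H1_square_integrable[OF \<phi>] and wg\<phi> = H1_weak_gradient[OF \<phi>]
  have si\<Phi>: "square_integrable (\<Phi> n)" for n
    unfolding \<Phi>_def[abs_def] by (rule square_integrable_affine[OF si\<phi> e0])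
  have wg\<Phi>: "is_weak_gradient (\<Phi> n) (\<lambda>x. e n *\<^sub>R weak_gradient (\<phi> (e n)) (t n + e n *\<^sub>R x))" for n
    unfolding \<Phi>_def[abs_def] by (rule is_weak_gradient_affine[OF si\<phi> wg\<phi> e0])
  note bounds = eps_norm_bounds[OF V_meas \<open>bounded (range V)\<close> Vc c \<open>a > 0\<close> \<phi>]
  have \<Phi>_l2: "(l2norm (\<Phi> n))\<^sup>2 \<le> (q n)\<^sup>2 / c" for n
  proof -
    have "(l2norm (\<phi> (e n)))\<^sup>2 = e n ^ 3 * (l2norm (\<Phi> n))\<^sup>2"
      using l2norm_affine[OF si\<phi> e0, of n n "t n"] e[of n] by (simp add: \<Phi>_def[abs_def])
    then have "e n ^ 3 * (c * (l2norm (\<Phi> n))\<^sup>2) \<le> e n ^ 3 * (q n)\<^sup>2"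
      using bounds(2)[of n "e n"] unfolding q2 by (simp add: mult_ac)
    then have "c * (l2norm (\<Phi> n))\<^sup>2 \<le> (q n)\<^sup>2"
      using e[of n] by (simp only: mult_le_cancel_left_pos zero_less_power)
    then show ?thesis using c by (simp add: pos_le_divide_eq mult.commute)
  qed
  have \<Phi>_energy: "dirichlet_energy (\<Phi> n) \<le> (q n)\<^sup>2 / a" for n
  proof -
    let ?g = "weak_gradient (\<phi> (e n))"
    have "dirichlet_energy (\<Phi> n) = (e n)\<^sup>2 * (l2norm (\<lambda>x. ?g (t n + e n *\<^sub>R x)))\<^sup>2"
      unfolding dirichlet_energy_eq[OF si\<Phi> wg\<Phi>] by (simp add: l2norm_power2 power_mult_distrib)
    moreover have "(l2norm ?g)\<^sup>2 = e n ^ 3 * (l2norm (\<lambda>x. ?g (t n + e n *\<^sub>R x)))\<^sup>2"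
      using l2norm_affine[OF H1_weak_gradient_square_integrable[OF \<phi>] e0, of n n "t n"] e[of n] by simp
    ultimately have "(e n)\<^sup>2 * a * dirichlet_energy (\<phi> (e n)) = e n ^ 3 * (a * dirichlet_energy (\<Phi> n))"
      by (simp add: dirichlet_energy_eq[OF si\<phi> wg\<phi>])
    then have "e n ^ 3 * (a * dirichlet_energy (\<Phi> n)) \<le> e n ^ 3 * (q n)\<^sup>2"
      using bounds(1)[of "e n" n] unfolding q2
      by (simp only: mult.commute[of "(q n)\<^sup>2" "e n ^ 3"])
    then have "a * dirichlet_energy (\<Phi> n) \<le> (q n)\<^sup>2"
      using e[of n] by (simp only: mult_le_cancel_left_pos zero_less_power)
    then show ?thesis using \<open>a > 0\<close> by (simp add: pos_le_divide_eq mult.commute)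
  qed
  show False
  proof (rule no_dispersing_solutions[where I = "{1..k}" and k = 1 and l = 2 and U = U and z = z
        and \<phi> = \<Phi> and v = "\<lambda>n x. u (e n) (t n + e n *\<^sub>R x)" and W = "\<lambda>n x. V (t n + e n *\<^sub>R x)"
        and w = "V (A 1)" and M = M and a = a and b = b and p = p])
    show "b > 0" "finite {1..k}" "1 \<in> {1..k}" "2 \<in> {1..k}" "(1::nat) \<noteq> 2"
      using \<open>b > 0\<close> one two by auto
    show "H1 (U i)" "0 < U i x" if "i \<in> {1..k}" for i x
      using solU[OF that] unfolding kirchhoff_solution_def by blast+
    show "kirchhoff_solution a b (\<lambda>_. V (A 1)) p (U 1)" by (rule solU[OF one])
    show "filterlim (\<lambda>n. norm (z i n - z j n)) at_top sequentially"
      if ij: "i \<in> {1..k}" "j \<in> {1..k}" "i \<noteq> j" for i j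
    proof -
      have "z i n - z j n = (1 / e n) *\<^sub>R (y j (e n) - y i (e n))" for n
        by (simp add: z_def algebra_simps)
      then have eq: "norm (z i n - z j n) = norm (y j (e n) - y i (e n)) * inverse (e n)" for n
        using e[of n] by (simp add: divide_inverse mult.commute)
      have "A j \<noteq> A i" using \<open>inj_on A {1..k}\<close> ij by (auto dest: inj_onD)
      then have pos: "0 < norm (A j - A i)" by simp
      have lim: "(\<lambda>n. norm (y j (e n) - y i (e n))) \<longlonglongrightarrow> norm (A j - A i)"
        by (intro tendsto_norm tendsto_diff y_lim ij)
      have top: "filterlim (\<lambda>n. inverse (e n)) at_top sequentially"
        by (rule filterlim_compose[OF filterlim_inverse_at_top_right e_lim])
      show ?thesis
        unfolding eq by (rule filterlim_tendsto_pos_mult_at_top[OF lim pos top])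
    qed
    show "z 1 n = 0" for n by (simp add: z_def)
    show "H1 (\<Phi> n)" for n using si\<Phi> wg\<Phi> by (auto simp: H1_def)
    show "(\<lambda>n. l2norm (\<Phi> n)) \<longlonglongrightarrow> 0"
    proof -
      have "(\<lambda>n. (q n)\<^sup>2 / c) \<longlonglongrightarrow> 0\<^sup>2 / c"
        by (rule tendsto_divide[OF tendsto_power[OF q] tendsto_const]) (use c in simp)
      then have lim: "(\<lambda>n. (q n)\<^sup>2 / c) \<longlonglongrightarrow> 0" by simp
      have "(\<lambda>n. (l2norm (\<Phi> n))\<^sup>2) \<longlonglongrightarrow> 0"
        by (rule Lim_null_comparison[OF always_eventually[OF allI] lim]) (use \<Phi>_l2 in simp)
      from tendsto_real_sqrt[OF this] show ?thesis by (simp add: l2norm_nonneg)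
    qed
    show "(\<lambda>n. dirichlet_energy (\<Phi> n)) \<longlonglongrightarrow> 0"
    proof -
      have "(\<lambda>n. (q n)\<^sup>2 / a) \<longlonglongrightarrow> 0\<^sup>2 / a"
        by (rule tendsto_divide[OF tendsto_power[OF q] tendsto_const]) (use \<open>a > 0\<close> in simp)
      then have lim: "(\<lambda>n. (q n)\<^sup>2 / a) \<longlonglongrightarrow> 0" by simp
      have "norm (dirichlet_energy (\<Phi> n)) \<le> (q n)\<^sup>2 / a" for n
        using \<Phi>_energy[of n] dirichlet_energy_eq[OF si\<Phi>[of n] wg\<Phi>[of n]] by simp
      then show ?thesis
        by (intro Lim_null_comparison[OF always_eventually lim]) blast
    qed
    show "u (e n) (t n + e n *\<^sub>R x) = (\<Sum>i\<in>{1..k}. U i (x + z i n)) + \<Phi> n x" for n x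
    proof -
      have "(1 / e n) *\<^sub>R (t n + e n *\<^sub>R x - y i (e n)) = x + z i n" for i
        using e0[of n] by (simp add: t_def z_def algebra_simps)
      then show ?thesis by (simp add: u_eq \<Phi>_def)
    qed
    show "(\<lambda>x. V (t n + e n *\<^sub>R x)) \<in> borel_measurable lebesgue" for n
      by (rule borel_measurable_affine_comp[OF V_meas e0])
    show "\<bar>V (t n + e n *\<^sub>R x)\<bar> \<le> M" for n x by (rule M)
    show "(\<lambda>n. V (t n + e n *\<^sub>R x)) \<longlonglongrightarrow> V (A 1)" for x
    proof -
      have "(\<lambda>n. t n + e n *\<^sub>R x) \<longlonglongrightarrow> A 1 + 0 *\<^sub>R x"
        unfolding t_def by (intro tendsto_add tendsto_scaleR tendsto_const y_lim one e_tendsto)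
      then have lim: "(\<lambda>n. t n + e n *\<^sub>R x) \<longlonglongrightarrow> A 1" by simp
      have "isCont V (A 1)"
        using \<open>continuous_on UNIV V\<close> by (simp add: continuous_on_eq_continuous_at)
      then show ?thesis by (rule isCont_tendsto_compose[OF _ lim])
    qed
    show "kirchhoff_solution a b (\<lambda>x. V (t n + e n *\<^sub>R x)) p (\<lambda>x. u (e n) (t n + e n *\<^sub>R x))" for n
      by (rule kirchhoff_solution_rescale[where t = "t n", OF sol e V_meas])
  qed
qed

end
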